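(* Let $F:\mathbb{R}^n\rightrightarrows\mathbb{R}^n$ satisfy assumptions (F) and (H), let $\mathcal{K}\subset\mathbb{R}^n$ be closed, and let $\mathcal{T}$ be the associated minimum time function. Assume that there exist constants $\delta>0$ and $\varphi_0\ge0$ such that $\mathcal{R}(t)$ is $\varphi_0$-convex for all $t\in[0,\delta]$. If $\mathcal{T}$ is continuous in $\mathcal{R}$, then there exists a continuous function $\varphi$ such that the epigraph of $\mathcal{T}_{|\mathcal{S}(\delta)}$ is $\varphi$-convex, where $\mathcal{S}(\delta)=\mathcal{R}(\delta)\setminus\mathcal{K}$ and $\mathcal{T}_{|\mathcal{S}(\delta)}$ is the restriction of $\mathcal{T}$ to $\mathcal{S}(\delta)$.
   Context: Assumption (F) on a multifunction $F:\mathbb{R}^n\rightrightarrows\mathbb{R}^n$: (F1) $F(x)$ is nonempty, convex and compact for each $x\in\mathbb{R}^n$; (F2) for each compact $Q\subset\mathbb{R}^n$ there is $L>0$ with $F(x)\subset F(y)+L|y-x|\bar{\mathbb{B}}$ for all $x,y\in Q$, where $\bar{\mathbb{B}}$ is the closed unit ball; (F3) there is $\gamma>0$ with $\max\{|v|:v\in F(x)\}\le\gamma(1+|x|)$ for all $x\in\mathbb{R}^n$. Maximized Hamiltonian: $H(x,p)=\max_{v\in F(x)}\langle v,p\rangle$; $\nabla_pH$ is its partial gradient in $p$. Assumption (H): for every $r>0$, (H1) there exists $c\ge0$ so that for every $p\in\mathbb{S}^{n-1}$ (the unit sphere) the mapping $x\mapsto H(x,p)$ is semiconvex with semiconvexity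 constant $c$; (H2) $\nabla_pH(x,p)$ exists and is Lipschitz in $x$ on $B(0,r)$, uniformly for $p\in\mathbb{R}^n\setminus\{0\}$. Here a function $g$ on an open set $\Omega$ is semiconvex with constant $c$ if it is continuous and $g(x+k)+g(x-k)-2g(x)\ge-c|k|^2$ whenever $[x-k,x+k]\subset\Omega$. A trajectory of $F$ starting at $x$ is an absolutely continuous $x(\cdot)$ on $[0,T]$ with $\dot x(t)\in F(x(t))$ for a.e. $t$ and $x(0)=x$. The minimum time function $\mathcal{T}:\mathbb{R}^n\to[0,+\infty]$ associated with the closed target $\mathcal{K}$ is $\mathcal{T}(x)=0$ if $x\in\mathcal{K}$, and otherwise $\mathcal{T}(x)=\inf\{T>0:\text{there is a trajectory } x(\cdot) \text{ of } F \text{ with } x(0)=x,\ x(T)\in\mathcal{K}\}$, with $\inf\emptyset=+\infty$. The controllable set is $\mathcal{R}=\{x:\mathcal{T}(x)<+\infty\}$, and for $t\ge0$, $\mathcal{R}(t)=\{x:\mathcal{T}(x)\le t\}$ (so $\mathcal{R}(0)=\mathcal{K}$). For a set $E$ and $x\in E$, the proximal normal cone $N^P_E(x)$ is the set of $v$ for which there is $\sigma\ge0$ with $\langle v,y-x\rangle\le\sigma|y-x|^2$ for all $y\in E$. Given a continuous $\varphi:E\to[0,+\infty)$, $E$ is $\varphi$-convex if $\langle v,y-x\rangle\le\varphi(x)|v||y-x|^2$ for all $x,y\in E$ and $v\in N^P_E(x)$; for a constant $\varphi_0\ge0$, $\varphi_0$-convex means $\varphi$-convex with $\varphi\equiv\varphi_0$.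 The epigraph of $\mathcal{T}_{|\mathcal{O}}$ is $\{(x,\beta)\in\mathcal{O}\times\mathbb{R}:\mathcal{T}(x)<+\infty,\ \beta\ge\mathcal{T}(x)\}$. *)

theory Defs
  imports "HOL-Analysis.Analysis"
begin

section \<open>Assumptions on the multifunction\<close>

definition assumption_F :: "('a::euclidean_space \<Rightarrow> 'a set) \<Rightarrow> bool" where
  "assumption_F F \<longleftrightarrow>
     (\<forall>x. F x \<noteq> {} \<and> convex (F x) \<and> compact (F x)) \<and>
     (\<forall>Q. compact Q \<longrightarrow>
        (\<exists>L>0. \<forall>x\<in>Q. \<forall>y\<in>Q. F x \<subseteq> {w + (L * norm (y - x)) *\<^sub>R b |w b. w \<in> F y \<and> b \<in> cball 0 1})) \<and>
     (\<exists>\<gamma>>0. \<forall>x. \<forall>v\<in>F x. norm v \<le> \<gamma> * (1 + norm x))"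

(* The supremum is a maximum whenever F x is nonempty and compact. *)
definition max_hamiltonian :: "('a::euclidean_space \<Rightarrow> 'a set) \<Rightarrow> 'a \<Rightarrow> 'a \<Rightarrow> real" where
  "max_hamiltonian F x p = (SUP v\<in>F x. v \<bullet> p)"

definition semiconvex_on :: "'a::euclidean_space set \<Rightarrow> real \<Rightarrow> ('a \<Rightarrow> real) \<Rightarrow> bool" where
  "semiconvex_on \<Omega> c g \<longleftrightarrow> continuous_on \<Omega> g \<and>
     (\<forall>x k. closed_segment (x - k) (x + k) \<subseteq> \<Omega> \<longrightarrow>
        g (x + k) + g (x - k) - 2 * g x \<ge> - c * (norm k)\<^sup>2)"

(* Both conditions are local: the constants c and L may depend on r. G is the partial
   gradient of the Hamiltonian in p; L does not depend on p. *)
definition assumption_H :: "('a::euclidean_space \<Rightarrow> 'a set) \<Rightarrow> bool" where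
  "assumption_H F \<longleftrightarrow> (\<forall>r>0.
     (\<exists>c\<ge>0. \<forall>p\<in>sphere 0 1. semiconvex_on (ball 0 r) c (\<lambda>x. max_hamiltonian F x p)) \<and>
     (\<exists>G. (\<forall>x\<in>ball 0 r. \<forall>p. p \<noteq> 0 \<longrightarrow> GDERIV (max_hamiltonian F x) p :> G x p) \<and>
          (\<exists>L. \<forall>p. p \<noteq> 0 \<longrightarrow> L-lipschitz_on (ball 0 r) (\<lambda>x. G x p))))"

section \<open>Trajectories and the minimum time function\<close>

definition abs_continuous_on :: "real set \<Rightarrow> (real \<Rightarrow> 'a::euclidean_space) \<Rightarrow> bool" where
  "abs_continuous_on I f \<longleftrightarrow>
     (\<forall>\<epsilon>>0. \<exists>\<delta>>0. \<forall>(n::nat) a b.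
        (\<forall>i<n. a i \<le> b i \<and> {a i..b i} \<subseteq> I) \<and>
        disjoint_family_on (\<lambda>i. {a i<..<b i}) {..<n} \<and>
        (\<Sum>i<n. b i - a i) < \<delta> \<longrightarrow>
        (\<Sum>i<n. norm (f (b i) - f (a i))) < \<epsilon>)"

definition trajectory ::
    "('a::euclidean_space \<Rightarrow> 'a set) \<Rightarrow> real \<Rightarrow> 'a \<Rightarrow> (real \<Rightarrow> 'a) \<Rightarrow> bool" where
  "trajectory F T x \<xi> \<longleftrightarrow>
     abs_continuous_on {0..T} \<xi> \<and>
     (AE t\<in>{0..T} in lebesgue. \<exists>v\<in>F (\<xi> t). (\<xi> has_vector_derivative v) (at t within {0..T})) \<and>
     \<xi> 0 = x"

definition min_time ::
    "('a::euclidean_space \<Rightarrow> 'a set) \<Rightarrow> 'a set \<Rightarrow> 'a \<Rightarrow> ereal" where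
  "min_time F K x =
     (if x \<in> K then 0 else Inf {ereal T |T. T > 0 \<and> (\<exists>\<xi>. trajectory F T x \<xi> \<and> \<xi> T \<in> K)})"

definition controllable_set :: "('a::euclidean_space \<Rightarrow> 'a set) \<Rightarrow> 'a set \<Rightarrow> 'a set" where
  "controllable_set F K = {x. min_time F K x < \<infinity>}"

definition reachable_within ::
    "('a::euclidean_space \<Rightarrow> 'a set) \<Rightarrow> 'a set \<Rightarrow> real \<Rightarrow> 'a set" where
  "reachable_within F K t = {x. min_time F K x \<le> ereal t}"

section \<open>Proximal normals and phi-convexity\<close>

definition proximal_normal_cone :: "'a::real_inner set \<Rightarrow> 'a \<Rightarrow> 'a set" where
  "proximal_normal_cone E x = {v. \<exists>\<sigma>\<ge>0. \<forall>y\<in>E. v \<bullet> (y - x) \<le> \<sigma> * (norm (y - x))\<^sup>2}"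

definition phi_convex :: "('a::real_inner \<Rightarrow> real) \<Rightarrow> 'a set \<Rightarrow> bool" where
  "phi_convex \<phi> E \<longleftrightarrow>
     continuous_on E \<phi> \<and> (\<forall>x\<in>E. \<phi> x \<ge> 0) \<and>
     (\<forall>x\<in>E. \<forall>y\<in>E. \<forall>v\<in>proximal_normal_cone E x.
        v \<bullet> (y - x) \<le> \<phi> x * norm v * (norm (y - x))\<^sup>2)"

(* The library's epigraph takes real-valued functions only. *)
definition ereal_epigraph :: "'a set \<Rightarrow> ('a \<Rightarrow> ereal) \<Rightarrow> ('a \<times> real) set" where
  "ereal_epigraph A f = {(x, \<beta>). x \<in> A \<and> f x < \<infinity> \<and> f x \<le> ereal \<beta>}"

end

theory Submission
  imports Defs
begin

text \<open>Let (v, l) be a proximal normal to the epigraph at (x, t0), where t0 is the minimum time at x;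
  then l \<le> 0 and v is a proximal normal to the sublevel set R(t0) at x. Comparing with trajectories
  through x gives H(x, -v) = -l. A point y of larger minimum time t is moved forward along a nearly
  optimal trajectory for the time t - t0; a point y with T(y) \<le> b < t0 is moved backward for the time
  t0 - b along velocities maximizing the Hamiltonian in the direction -v. Either way it lands in R(t0),
  whose convexity inequality applies, and the displacement contributes H(x, -v) times the elapsed time
  up to a quadratic error. At a point (x, b) with b > t0 every normal is horizontal, and
  continuity of the minimum time makes it normal to the largest sublevel set.\<close>

section \<open>Absolutely continuous functions\<close>

text \<open>Three obstacles shape the proof. Optimal trajectories are not at hand, only trajectories
  whose duration is arbitrarily close to the infimum; the excess is made quadratic in the elapsed
  time or removed by a limit. Velocities exist only almost everywhere, so displacements are
  controlled by a growth estimate for absolutely continuous functions. And the two halves of H(x,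
  -v) = -l hold under different conditions: "at most" needs t0 < \<delta>, because points reached
  backward from x must stay in R(\<delta>), while "at least" needs t0 > 0. Each half is used only
  against points y whose position enforces its condition: a later y gives t0 < \<delta>, a height b
  < t0 gives t0 > 0. The comparison by trajectories works only for points close to (x, t0); for the
  others Cauchy-Schwarz suffices, since the right-hand side is quadratic. The flow constants depend
  on a bound for |x|, so there is one constant per ball, and these are glued to a continuous
  function of |x|.\<close>

lemma abs_continuous_on_subset:
  "abs_continuous_on I f \<Longrightarrow> J \<subseteq> I \<Longrightarrow> abs_continuous_on J f"
  unfolding abs_continuous_on_def by (meson subset_trans)

lemma abs_continuous_on_inner:
  assumes "abs_continuous_on I f"
  shows "abs_continuous_on I (\<lambda>t. f t \<bullet> p)"
  unfolding abs_continuous_on_def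
proof (intro allI impI)
  fix e :: real assume "e > 0"
  then have "e / (norm p + 1) > 0"
    by (simp add: add_nonneg_pos)
  then obtain d where "d > 0" and d: "\<And>(n::nat) a b.
        (\<forall>i<n. a i \<le> b i \<and> {a i..b i} \<subseteq> I) \<and>
        disjoint_family_on (\<lambda>i. {a i<..<b i}) {..<n} \<and>
        (\<Sum>i<n. b i - a i) < d \<Longrightarrow>
        (\<Sum>i<n. norm (f (b i) - f (a i))) < e / (norm p + 1)"
    using assms unfolding abs_continuous_on_def by blast
  show "\<exists>d>0. \<forall>(n::nat) a b.
        (\<forall>i<n. a i \<le> b i \<and> {a i..b i} \<subseteq> I) \<and>
        disjoint_family_on (\<lambda>i. {a i<..<b i}) {..<n} \<and>
        (\<Sum>i<n. b i - a i) < d \<longrightarrow>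
        (\<Sum>i<n. norm (f (b i) \<bullet> p - f (a i) \<bullet> p)) < e"
  proof (intro exI conjI allI impI)
    show "d > 0" by fact
    fix n :: nat and a b :: "nat \<Rightarrow> real"
    assume h: "(\<forall>i<n. a i \<le> b i \<and> {a i..b i} \<subseteq> I) \<and>
        disjoint_family_on (\<lambda>i. {a i<..<b i}) {..<n} \<and>
        (\<Sum>i<n. b i - a i) < d"
    have "(\<Sum>i<n. norm (f (b i) \<bullet> p - f (a i) \<bullet> p))
        \<le> (\<Sum>i<n. norm (f (b i) - f (a i)) * (norm p + 1))"
    proof (rule sum_mono)
      fix i
      have "norm (f (b i) \<bullet> p - f (a i) \<bullet> p) \<le> norm (f (b i) - f (a i)) * norm p"
        unfolding inner_diff_left[symmetric] real_norm_def by (rule Cauchy_Schwarz_ineq2)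
      also have "\<dots> \<le> norm (f (b i) - f (a i)) * (norm p + 1)"
        by (simp add: mult_left_mono)
      finally show "norm (f (b i) \<bullet> p - f (a i) \<bullet> p) \<le> norm (f (b i) - f (a i)) * (norm p + 1)" .
    qed
    also have "\<dots> = (\<Sum>i<n. norm (f (b i) - f (a i))) * (norm p + 1)"
      by (simp add: sum_distrib_right)
    also have "\<dots> < e"
      using d[OF h] by (simp add: pos_less_divide_eq add_nonneg_pos)
    finally show "(\<Sum>i<n. norm (f (b i) \<bullet> p - f (a i) \<bullet> p)) < e" .
  qed
qed

lemma abs_continuous_on_imp_continuous_on:
  assumes "abs_continuous_on {a..b} f"
  shows "continuous_on {a..b} f"
  unfolding continuous_on_iff
proof (intro ballI allI impI)
  fix t and e :: real assume t: "t \<in> {a..b}" and "e > 0"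
  then obtain d where "d > 0" and d: "\<And>(n::nat) a' b'.
        (\<forall>i<n. a' i \<le> b' i \<and> {a' i..b' i} \<subseteq> {a..b}) \<and>
        disjoint_family_on (\<lambda>i. {a' i<..<b' i}) {..<n} \<and>
        (\<Sum>i<n. b' i - a' i) < d \<Longrightarrow>
        (\<Sum>i<n. norm (f (b' i) - f (a' i))) < e"
    using assms unfolding abs_continuous_on_def by blast
  have "dist (f s) (f t) < e" if "s \<in> {a..b}" "dist s t < d" for s
  proof -
    have "norm (f (max s t) - f (min s t)) < e"
      using d[of 1 "\<lambda>_. min s t" "\<lambda>_. max s t"] that t
      by (auto simp: disjoint_family_on_def dist_real_def max_def min_def)
    then show ?thesis
      by (auto simp: dist_norm max_def min_def norm_minus_commute split: if_splits)
  qed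
  then show "\<exists>d>0. \<forall>s\<in>{a..b}. dist s t < d \<longrightarrow> dist (f s) (f t) < e"
    using \<open>d > 0\<close> by blast
qed

lemma abs_continuous_onI_lipschitz:
  assumes "L-lipschitz_on I f"
  shows "abs_continuous_on I f"
  unfolding abs_continuous_on_def
proof (intro allI impI)
  fix e :: real assume "e > 0"
  have L: "L \<ge> 0" using assms lipschitz_on_nonneg by blast
  show "\<exists>d>0. \<forall>(n::nat) a b.
        (\<forall>i<n. a i \<le> b i \<and> {a i..b i} \<subseteq> I) \<and>
        disjoint_family_on (\<lambda>i. {a i<..<b i}) {..<n} \<and>
        (\<Sum>i<n. b i - a i) < d \<longrightarrow>
        (\<Sum>i<n. norm (f (b i) - f (a i))) < e"
  proof (intro exI conjI allI impI)
    show "e / (L + 1) > 0" using L \<open>e > 0\<close> by simp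
    fix n :: nat and a b :: "nat \<Rightarrow> real"
    assume h: "(\<forall>i<n. a i \<le> b i \<and> {a i..b i} \<subseteq> I) \<and>
        disjoint_family_on (\<lambda>i. {a i<..<b i}) {..<n} \<and>
        (\<Sum>i<n. b i - a i) < e / (L + 1)"
    have "(\<Sum>i<n. norm (f (b i) - f (a i))) \<le> (\<Sum>i<n. (L + 1) * (b i - a i))"
    proof (rule sum_mono)
      fix i assume "i \<in> {..<n}"
      then have "a i \<le> b i" "{a i..b i} \<subseteq> I" using h by auto
      then have i: "a i \<le> b i" "a i \<in> I" "b i \<in> I" by auto
      then have "norm (f (b i) - f (a i)) \<le> L * (b i - a i)"
        using lipschitz_onD[OF assms i(3) i(2)] by (simp add: dist_norm)
      also have "\<dots> \<le> (L + 1) * (b i - a i)"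
        using i by (simp add: mult_right_mono)
      finally show "norm (f (b i) - f (a i)) \<le> (L + 1) * (b i - a i)" .
    qed
    also have "\<dots> = (L + 1) * (\<Sum>i<n. b i - a i)"
      by (simp add: sum_distrib_left)
    also have "\<dots> < e"
      using h L by (simp add: pos_less_divide_eq mult.commute)
    finally show "(\<Sum>i<n. norm (f (b i) - f (a i))) < e" .
  qed
qed

lemma abs_continuous_on_translate:
  assumes "abs_continuous_on {a + c..b + c} f"
  shows "abs_continuous_on {a..b} (\<lambda>t. f (t + c))"
  unfolding abs_continuous_on_def
proof (intro allI impI)
  fix e :: real assume "e > 0"
  then obtain d where "d > 0" and d: "\<And>(n::nat) a' b'.
        (\<forall>i<n. a' i \<le> b' i \<and> {a' i..b' i} \<subseteq> {a + c..b + c}) \<and>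
        disjoint_family_on (\<lambda>i. {a' i<..<b' i}) {..<n} \<and>
        (\<Sum>i<n. b' i - a' i) < d \<Longrightarrow>
        (\<Sum>i<n. norm (f (b' i) - f (a' i))) < e"
    using assms unfolding abs_continuous_on_def by blast
  show "\<exists>d>0. \<forall>(n::nat) a' b'.
        (\<forall>i<n. a' i \<le> b' i \<and> {a' i..b' i} \<subseteq> {a..b}) \<and>
        disjoint_family_on (\<lambda>i. {a' i<..<b' i}) {..<n} \<and>
        (\<Sum>i<n. b' i - a' i) < d \<longrightarrow>
        (\<Sum>i<n. norm (f (b' i + c) - f (a' i + c))) < e"
  proof (intro exI conjI allI impI)
    show "d > 0" by fact
    fix n :: nat and a' b' :: "nat \<Rightarrow> real"
    assume h: "(\<forall>i<n. a' i \<le> b' i \<and> {a' i..b' i} \<subseteq> {a..b}) \<and>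
        disjoint_family_on (\<lambda>i. {a' i<..<b' i}) {..<n} \<and>
        (\<Sum>i<n. b' i - a' i) < d"
    have "disjoint_family_on (\<lambda>i. {a' i + c<..<b' i + c}) {..<n}"
      unfolding disjoint_family_on_def
    proof (intro ballI impI)
      fix i j assume "i \<in> {..<n}" "j \<in> {..<n}" "i \<noteq> j"
      then have "{a' i<..<b' i} \<inter> {a' j<..<b' j} = {}" using h by (auto simp: disjoint_family_on_def)
      moreover have "t - c \<in> {a' k<..<b' k}" if "t \<in> {a' k + c<..<b' k + c}" for t k
        using that by auto
      ultimately show "{a' i + c<..<b' i + c} \<inter> {a' j + c<..<b' j + c} = {}"
        by blast
    qed
    moreover have "a' i + c \<le> b' i + c \<and> {a' i + c..b' i + c} \<subseteq> {a + c..b + c}" if "i < n" for i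
    proof -
      have "a' i \<le> b' i" "{a' i..b' i} \<subseteq> {a..b}" using h that by auto
      then show ?thesis by auto
    qed
    ultimately show "(\<Sum>i<n. norm (f (b' i + c) - f (a' i + c))) < e"
      using h by (intro d) simp
  qed
qed

text \<open>Cutting every interval at \<open>s\<close> gives one family in each half; the triangle
  inequality through \<open>f s\<close> bounds the original sum by the two sums, each below
  \<open>e / 2\<close>.\<close>

lemma abs_continuous_on_join:
  assumes "abs_continuous_on {a..s} f" "abs_continuous_on {s..b} f" "a \<le> s" "s \<le> b"
  shows "abs_continuous_on {a..b} f"
  unfolding abs_continuous_on_def
proof (intro allI impI)
  fix e :: real assume "e > 0"
  then have "e / 2 > 0" by simp
  then obtain d1 where "d1 > 0" and d1: "\<And>(n::nat) a' b'.
        (\<forall>i<n. a' i \<le> b' i \<and> {a' i..b' i} \<subseteq> {a..s}) \<and>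
        disjoint_family_on (\<lambda>i. {a' i<..<b' i}) {..<n} \<and>
        (\<Sum>i<n. b' i - a' i) < d1 \<Longrightarrow>
        (\<Sum>i<n. norm (f (b' i) - f (a' i))) < e / 2"
    using assms(1) unfolding abs_continuous_on_def by blast
  obtain d2 where "d2 > 0" and d2: "\<And>(n::nat) a' b'.
        (\<forall>i<n. a' i \<le> b' i \<and> {a' i..b' i} \<subseteq> {s..b}) \<and>
        disjoint_family_on (\<lambda>i. {a' i<..<b' i}) {..<n} \<and>
        (\<Sum>i<n. b' i - a' i) < d2 \<Longrightarrow>
        (\<Sum>i<n. norm (f (b' i) - f (a' i))) < e / 2"
    using assms(2) \<open>e / 2 > 0\<close> unfolding abs_continuous_on_def by blast
  show "\<exists>d>0. \<forall>(n::nat) a' b'.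
        (\<forall>i<n. a' i \<le> b' i \<and> {a' i..b' i} \<subseteq> {a..b}) \<and>
        disjoint_family_on (\<lambda>i. {a' i<..<b' i}) {..<n} \<and>
        (\<Sum>i<n. b' i - a' i) < d \<longrightarrow>
        (\<Sum>i<n. norm (f (b' i) - f (a' i))) < e"
  proof (intro exI conjI allI impI)
    show "min d1 d2 > 0" using \<open>d1 > 0\<close> \<open>d2 > 0\<close> by simp
    fix n :: nat and a' b' :: "nat \<Rightarrow> real"
    assume h: "(\<forall>i<n. a' i \<le> b' i \<and> {a' i..b' i} \<subseteq> {a..b}) \<and>
        disjoint_family_on (\<lambda>i. {a' i<..<b' i}) {..<n} \<and>
        (\<Sum>i<n. b' i - a' i) < min d1 d2"
    then have le: "a' i \<le> b' i" "a \<le> a' i" "b' i \<le> b" if "i < n" for i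
      using that by auto
    have dis: "disjoint_family_on (\<lambda>i. {A i<..<B i}) {..<n}"
      if "\<And>i. i < n \<Longrightarrow> {A i<..<B i} \<subseteq> {a' i<..<b' i}" for A B :: "nat \<Rightarrow> real"
      unfolding disjoint_family_on_def
    proof (intro ballI impI)
      fix i j assume ij: "i \<in> {..<n}" "j \<in> {..<n}" "i \<noteq> j"
      then have "{a' i<..<b' i} \<inter> {a' j<..<b' j} = {}"
        using h by (simp add: disjoint_family_on_def)
      then show "{A i<..<B i} \<inter> {A j<..<B j} = {}"
        using that[of i] that[of j] ij by blast
    qed
    \<comment> \<open>Applying \<open>min s\<close> to both endpoints keeps the part left of
      \<open>s\<close>; an interval right of \<open>s\<close> collapses to a point and contributes
      nothing, so the index set stays the same.\<close>
    have "(\<Sum>i<n. norm (f (min s (b' i)) - f (min s (a' i)))) < e / 2"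
    proof (intro d1 conjI dis)
      have "(\<Sum>i<n. min s (b' i) - min s (a' i)) \<le> (\<Sum>i<n. b' i - a' i)"
        by (rule sum_mono) (use le(1) in \<open>force simp: min_def\<close>)
      then show "(\<Sum>i<n. min s (b' i) - min s (a' i)) < d1" using h by simp
      show "\<forall>i<n. min s (a' i) \<le> min s (b' i) \<and> {min s (a' i)..min s (b' i)} \<subseteq> {a..s}"
      proof (intro allI impI conjI)
        fix i assume "i < n"
        then show "min s (a' i) \<le> min s (b' i)" using le by (intro min.mono) auto
        show "{min s (a' i)..min s (b' i)} \<subseteq> {a..s}" using le[OF \<open>i < n\<close>] assms(3) by auto
      qed
      show "{min s (a' i)<..<min s (b' i)} \<subseteq> {a' i<..<b' i}" if "i < n" for i
        by (intro subsetI) (auto simp: min_less_iff_disj)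
    qed
    moreover have "(\<Sum>i<n. norm (f (max s (b' i)) - f (max s (a' i)))) < e / 2"
    proof (intro d2 conjI dis)
      have "(\<Sum>i<n. max s (b' i) - max s (a' i)) \<le> (\<Sum>i<n. b' i - a' i)"
        by (rule sum_mono) (use le(1) in \<open>force simp: max_def\<close>)
      then show "(\<Sum>i<n. max s (b' i) - max s (a' i)) < d2" using h by simp
      show "\<forall>i<n. max s (a' i) \<le> max s (b' i) \<and> {max s (a' i)..max s (b' i)} \<subseteq> {s..b}"
      proof (intro allI impI conjI)
        fix i assume "i < n"
        then show "max s (a' i) \<le> max s (b' i)" using le by (intro max.mono) auto
        show "{max s (a' i)..max s (b' i)} \<subseteq> {s..b}" using le[OF \<open>i < n\<close>] assms(4) by auto
      qed
      show "{max s (a' i)<..<max s (b' i)} \<subseteq> {a' i<..<b' i}" if "i < n" for i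
        by (intro subsetI) (auto simp: less_max_iff_disj)
    qed
    moreover have "(\<Sum>i<n. norm (f (b' i) - f (a' i))) \<le>
       (\<Sum>i<n. norm (f (min s (b' i)) - f (min s (a' i))) + norm (f (max s (b' i)) - f (max s (a' i))))"
    proof (rule sum_mono)
      fix i assume "i \<in> {..<n}"
      then have "a' i \<le> b' i" using le by simp
      moreover have "norm (f (b' i) - f (a' i)) \<le> norm (f s - f (a' i)) + norm (f (b' i) - f s)"
        using norm_triangle_ineq[of "f s - f (a' i)" "f (b' i) - f s"] by simp
      ultimately show "norm (f (b' i) - f (a' i)) \<le>
          norm (f (min s (b' i)) - f (min s (a' i))) + norm (f (max s (b' i)) - f (max s (a' i)))"
        by (auto simp: min_def max_def)
    qed
    ultimately show "(\<Sum>i<n. norm (f (b' i) - f (a' i))) < e"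
      by (simp add: sum.distrib)
  qed
qed

lemma abs_continuous_on_cong:
  assumes "\<And>t. t \<in> I \<Longrightarrow> f t = g t"
  shows "abs_continuous_on I f \<longleftrightarrow> abs_continuous_on I g"
proof -
  have "(\<Sum>i<n. norm (f (b i) - f (a i))) = (\<Sum>i<n. norm (g (b i) - g (a i)))"
    if "\<forall>i<n. a i \<le> b i \<and> {a i..b i} \<subseteq> I" for n :: nat and a b :: "nat \<Rightarrow> real"
  proof (rule sum.cong)
    fix i assume "i \<in> {..<n}"
    then have "a i \<le> b i" "{a i..b i} \<subseteq> I" using that by auto
    then have "a i \<in> I" "b i \<in> I" by auto
    then show "norm (f (b i) - f (a i)) = norm (g (b i) - g (a i))"
      by (simp add: assms)
  qed simp
  then show ?thesis
    unfolding abs_continuous_on_def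
    by (intro all_cong1 imp_cong ex_cong1 conj_cong refl) simp
qed

section \<open>Growth bounds from derivatives that exist almost everywhere\<close>

lemma AE_lebesgue_translate:
  fixes c :: real
  assumes "AE t in lebesgue. P t"
  shows "AE t in lebesgue. P (c + t)"
proof -
  from AE_E3[OF assms] obtain N where "N \<in> null_sets lebesgue" "\<And>t. t \<in> space lebesgue - N \<Longrightarrow> P t"
    by metis
  then have N: "N \<in> null_sets lebesgue" "\<And>t. t \<notin> N \<Longrightarrow> P t" by auto
  then have "negligible ((+) (- c) ` N)"
    by (intro negligible_translation) (simp add: negligible_iff_null_sets)
  then have "(+) (- c) ` N \<in> null_sets lebesgue" by (simp add: negligible_iff_null_sets)
  then show ?thesis
  proof (rule AE_I')
    show "{t \<in> space lebesgue. \<not> P (c + t)} \<subseteq> (+) (- c) ` N"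
      using N(2) by (force simp: image_iff)
  qed
qed

text \<open>Intervals tagged in the exceptional null set lie in an open set of small measure, where
  absolute continuity controls the increments; on the others the derivative does.\<close>

lemma abs_continuous_on_increment_le:
  fixes f :: "real \<Rightarrow> real"
  assumes "a \<le> b" and ac: "abs_continuous_on {a..b} f"
    and ae: "AE t\<in>{a..b} in lebesgue. \<exists>d\<le>c. (f has_real_derivative d) (at t within {a..b})"
  shows "f b - f a \<le> c * (b - a)"
proof (rule field_le_epsilon)
  fix \<epsilon> :: real assume "\<epsilon> > 0"
  \<comment> \<open>The estimate loses \<open>e\<close> on the intervals tagged in the null set,
    \<open>e\<close> through their total length, and \<open>e * (b - a)\<close> on the rest.\<close>
  define e where "e = \<epsilon> / (b - a + 2)"
  have "e > 0" unfolding e_def using \<open>\<epsilon> > 0\<close> \<open>a \<le> b\<close> by simp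
  then obtain d0 where "d0 > 0" and d0: "\<And>(n::nat) a' b'.
        (\<forall>i<n. a' i \<le> b' i \<and> {a' i..b' i} \<subseteq> {a..b}) \<and>
        disjoint_family_on (\<lambda>i. {a' i<..<b' i}) {..<n} \<and>
        (\<Sum>i<n. b' i - a' i) < d0 \<Longrightarrow>
        (\<Sum>i<n. norm (f (b' i) - f (a' i))) < e"
    using ac unfolding abs_continuous_on_def by blast
  \<comment> \<open>The second entry gives \<open>\<bar>c\<bar> * d \<le> e\<close>. It matters for
    negative \<open>c\<close>, where dropping length up to \<open>d\<close> from
    \<open>c * (b - a)\<close> costs up to \<open>\<bar>c\<bar> * d\<close>.\<close>
  define d where "d = min d0 (e / (\<bar>c\<bar> + 1))"
  have "d > 0" "d \<le> d0"
    unfolding d_def using \<open>d0 > 0\<close> \<open>e > 0\<close> by auto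
  have "\<bar>c\<bar> * d \<le> (\<bar>c\<bar> + 1) * (e / (\<bar>c\<bar> + 1))"
    unfolding d_def using \<open>d0 > 0\<close> \<open>e > 0\<close> by (intro mult_mono) auto
  also have "\<dots> = e" by simp
  finally have "\<bar>c\<bar> * d \<le> e" .
  obtain N where N: "N \<in> null_sets lebesgue"
    and good: "\<And>t. t \<in> {a..b} - N \<Longrightarrow> \<exists>d\<le>c. (f has_real_derivative d) (at t within {a..b})"
  proof -
    from AE_E3[OF ae] obtain N where "N \<in> null_sets lebesgue"
      "\<And>t. t \<in> space lebesgue - N \<Longrightarrow> t \<in> {a..b} \<longrightarrow> (\<exists>d\<le>c. (f has_real_derivative d) (at t within {a..b}))"
      by metis
    then show thesis by (intro that[of N]) auto
  qed
  obtain U where "open U" "N \<subseteq> U" and Um: "U \<in> lmeasurable" "measure lebesgue U < d"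
  proof -
    have "N \<in> sets lebesgue" using N by auto
    from sets_lebesgue_outer_open[OF this \<open>d > 0\<close>]
    obtain T where T: "open T" "N \<subseteq> T" "T - N \<in> lmeasurable" "emeasure lebesgue (T - N) < ennreal d"
      by blast
    have "T \<in> sets lebesgue" using \<open>open T\<close> by simp
    then have em: "emeasure lebesgue T < ennreal d"
      using emeasure_Diff_null_set[OF N, of T] T(4) by simp
    then have "T \<in> lmeasurable"
      using \<open>T \<in> sets lebesgue\<close> by (intro fmeasurableI) (auto intro: less_trans)
    moreover have "measure lebesgue T < d"
      using em \<open>d > 0\<close> emeasure_eq_measure2[OF \<open>T \<in> lmeasurable\<close>]
      by (simp add: ennreal_less_iff)
    ultimately show thesis using that T(1,2) by blast
  qed
  have "\<exists>r>0. ball t r \<subseteq> U" if "t \<in> N" for t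
    using \<open>open U\<close> \<open>N \<subseteq> U\<close> that openE by blast
  then obtain r where r: "\<And>t. t \<in> N \<Longrightarrow> r t > 0 \<and> ball t (r t) \<subseteq> U" by metis
  \<comment> \<open>Straddle estimate: the tag lies between \<open>u\<close> and \<open>v\<close>,
    so the errors on its two sides add up to \<open>e * (v - u)\<close>.\<close>
  have "\<exists>q>0. \<forall>u v. u \<in> {a..b} \<and> v \<in> {a..b} \<and> u \<le> t \<and> t \<le> v \<and> u \<in> ball t q \<and> v \<in> ball t q
          \<longrightarrow> f v - f u \<le> (c + e) * (v - u)" if t: "t \<in> {a..b} - N" for t
  proof -
    obtain D where "D \<le> c" and D: "(f has_real_derivative D) (at t within {a..b})"
      using good[OF t] by blast
    from D have "(f has_derivative (\<lambda>x. x * D)) (at t within {a..b})"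
      by (simp add: has_field_derivative_def mult.commute[of D] mult_commute_abs)
    then obtain q where "q > 0" and q: "\<And>y. y \<in> {a..b} \<Longrightarrow> norm (y - t) < q \<Longrightarrow>
        norm (f y - f t - (y - t) * D) \<le> e * norm (y - t)"
      unfolding has_derivative_within_alt using \<open>e > 0\<close> by blast
    have "f v - f u \<le> (c + e) * (v - u)"
      if "u \<in> {a..b}" "v \<in> {a..b}" "u \<le> t" "t \<le> v" "u \<in> ball t q" "v \<in> ball t q" for u v
    proof -
      have 1: "f v - f t \<le> (v - t) * D + e * (v - t)"
        using q[of v] that by (auto simp: dist_real_def abs_if split: if_splits)
      have 2: "f t - f u \<le> (t - u) * D + e * (t - u)"
      proof -
        have "\<bar>f u - f t - (u - t) * D\<bar> \<le> e * (t - u)"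
          using q[of u] that by (simp add: dist_real_def)
        then show ?thesis by (simp add: abs_le_iff algebra_simps)
      qed
      have "f v - f u \<le> (v - u) * D + e * (v - u)"
        using 1 2 by (simp add: algebra_simps)
      also have "\<dots> \<le> (v - u) * c + e * (v - u)"
        using \<open>D \<le> c\<close> that by (simp add: mult_left_mono)
      finally show ?thesis by (simp add: algebra_simps)
    qed
    then show ?thesis using \<open>q > 0\<close> by blast
  qed
  then obtain q where q: "\<And>t. t \<in> {a..b} - N \<Longrightarrow> q t > 0"
    "\<And>t u v. t \<in> {a..b} - N \<Longrightarrow> u \<in> {a..b} \<Longrightarrow> v \<in> {a..b} \<Longrightarrow> u \<le> t \<Longrightarrow> t \<le> v \<Longrightarrow>
        u \<in> ball t (q t) \<Longrightarrow> v \<in> ball t (q t) \<Longrightarrow> f v - f u \<le> (c + e) * (v - u)"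
    by metis
  \<comment> \<open>A gauge is a total function, hence the default radius 1 off
    \<open>{a..b}\<close>; no tag lies there.\<close>
  define g where "g t = (if t \<in> N then ball t (r t) else if t \<in> {a..b} then ball t (q t) else ball t 1)" for t
  have "gauge g"
    unfolding gauge_def g_def using r q(1) by auto
  then obtain p where p: "p tagged_division_of {a..b}" "g fine p"
    using fine_division_exists_real by blast
  have fin: "finite p" using p by auto
  have pK: "x \<in> {a..b} \<and> x \<in> K \<and> K = {Inf K..Sup K} \<and> Inf K \<le> x \<and> x \<le> Sup K \<and> Inf K \<in> {a..b} \<and> Sup K \<in> {a..b}
      \<and> K \<subseteq> g x \<and> K \<subseteq> {a..b}"
    if mem: "(x, K) \<in> p" for x K
  proof -
    have xK: "x \<in> K" "K \<subseteq> {a..b}" using tagged_division_ofD[OF p(1)] mem by auto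
    obtain u v where K: "K = {u..v}" using tagged_division_ofD(4)[OF p(1) mem] by auto
    with xK have "u \<le> v" by auto
    then show ?thesis using xK K fineD[OF p(2) mem] by auto
  qed
  let ?i = "\<lambda>(x::real, K). f (Sup K) - f (Inf K)"
  define pN where "pN = {xK \<in> p. fst xK \<in> N}"
  have pN: "sum ?i pN \<le> e \<and> 0 \<le> (\<Sum>(x,K)\<in>pN. Sup K - Inf K) \<and> (\<Sum>(x,K)\<in>pN. Sup K - Inf K) \<le> d"
  proof -
    \<comment> \<open>Absolute continuity is stated for families indexed by \<open>{..<n}\<close>,
      so the intervals tagged in \<open>N\<close> are enumerated.\<close>
    have finN: "finite pN" using fin by (simp add: pN_def)
    then obtain h where h: "bij_betw h {0..<card pN} pN"
      using ex_bij_betw_nat_finite by blast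
    define n where "n = card pN"
    have h: "bij_betw h {..<n} pN" using h unfolding n_def by (simp add: atLeast0LessThan)
    define A where "A i = Inf (snd (h i))" for i
    define B where "B i = Sup (snd (h i))" for i
    have hp: "h i \<in> p" "fst (h i) \<in> N" if "i < n" for i
      using bij_betwE[OF h] that by (auto simp: pN_def)
    have AB: "snd (h i) = {A i..B i} \<and> A i \<le> B i \<and> {A i..B i} \<subseteq> {a..b} \<and> {A i..B i} \<subseteq> U" if "i < n" for i
    proof -
      have "(fst (h i), snd (h i)) \<in> p" using hp[OF that] by simp
      from pK[OF this] hp(2)[OF that] r[of "fst (h i)"] show ?thesis
        unfolding A_def B_def g_def by (auto simp: subset_iff)
    qed
    have dis: "disjoint_family_on (\<lambda>i. {A i<..<B i}) {..<n}"
      unfolding disjoint_family_on_def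
    proof (intro ballI impI)
      fix i j assume ij: "i \<in> {..<n}" "j \<in> {..<n}" "i \<noteq> j"
      then have "h i \<noteq> h j" using h by (auto simp: bij_betw_def inj_on_def)
      moreover have "(fst (h i), snd (h i)) \<in> p" "(fst (h j), snd (h j)) \<in> p" using hp ij by auto
      ultimately have "interior (snd (h i)) \<inter> interior (snd (h j)) = {}"
        using tagged_division_ofD(5)[OF p(1)] by (metis prod.collapse)
      then show "{A i<..<B i} \<inter> {A j<..<B j} = {}"
        using AB ij by (simp add: interior_atLeastAtMost_real)
    qed
    \<comment> \<open>The gauge keeps these intervals inside \<open>U\<close> and their interiors
      are disjoint, so their total length is at most the measure of \<open>U\<close>.\<close>
    have "(\<Sum>i<n. B i - A i) = (\<Sum>i<n. measure lebesgue {A i<..<B i})"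
      using AB by (intro sum.cong) (auto simp: measure_completion)
    also have "\<dots> = measure lebesgue (\<Union>i<n. {A i<..<B i})"
      by (rule measure_finite_Union[symmetric]) (use dis AB in auto)
    also have "\<dots> \<le> measure lebesgue U"
      using AB Um(1) by (intro measure_mono_fmeasurable) (auto, fastforce)
    also have "\<dots> < d" by (fact Um(2))
    finally have sumd: "(\<Sum>i<n. B i - A i) < d" .
    then have "(\<Sum>i<n. norm (f (B i) - f (A i))) < e"
      using d0[of n A B] AB dis sumd \<open>d \<le> d0\<close> by auto
    moreover have "sum ?i pN = (\<Sum>i<n. f (B i) - f (A i))"
      using sum.reindex_bij_betw[OF h, of ?i] by (simp add: A_def B_def case_prod_beta)
    moreover have "\<dots> \<le> (\<Sum>i<n. norm (f (B i) - f (A i)))"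
      by (intro sum_mono) auto
    moreover have "(\<Sum>(x,K)\<in>pN. Sup K - Inf K) = (\<Sum>i<n. B i - A i)"
      using sum.reindex_bij_betw[OF h, of "\<lambda>(x,K). Sup K - Inf K"] by (simp add: A_def B_def case_prod_beta)
    moreover have "0 \<le> (\<Sum>i<n. B i - A i)"
      using AB by (intro sum_nonneg) auto
    ultimately show ?thesis using sumd by linarith
  qed
  have "f b - f a = sum ?i p"
    by (rule additive_tagged_division_1[OF \<open>a \<le> b\<close> p(1), symmetric])
  also have "\<dots> = sum ?i pN + sum ?i (p - pN)"
    using fin by (subst sum.subset_diff[of pN p]) (auto simp: pN_def)
  also have "\<dots> \<le> e + (\<Sum>(x,K)\<in>p - pN. (c + e) * (Sup K - Inf K))"
  proof (rule add_mono)
    show "sum ?i pN \<le> e" using pN by simp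
    show "sum ?i (p - pN) \<le> (\<Sum>(x,K)\<in>p - pN. (c + e) * (Sup K - Inf K))"
    proof (rule sum_mono, clarify)
      fix x K assume xK: "(x, K) \<in> p" "(x, K) \<notin> pN"
      then have "x \<notin> N" by (auto simp: pN_def)
      with pK[OF xK(1)] have "K \<subseteq> ball x (q x)" by (simp add: g_def split: if_splits)
      moreover have "Inf K \<in> K" "Sup K \<in> K" using pK[OF xK(1)] by (metis atLeastAtMost_iff order.trans order_refl)+
      ultimately show "f (Sup K) - f (Inf K) \<le> (c + e) * (Sup K - Inf K)"
        using pK[OF xK(1)] \<open>x \<notin> N\<close> by (intro q(2)[of x]) auto
    qed
  qed
  also have "\<dots> = e + (c + e) * (b - a - (\<Sum>(x,K)\<in>pN. Sup K - Inf K))"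
  proof -
    have "b - a = (\<Sum>(x,K)\<in>p. Sup K - Inf K)"
      using additive_tagged_division_1[OF \<open>a \<le> b\<close> p(1), of "\<lambda>x. x"] by simp
    also have "\<dots> = (\<Sum>(x,K)\<in>p - pN. Sup K - Inf K) + (\<Sum>(x,K)\<in>pN. Sup K - Inf K)"
      using fin by (subst sum.subset_diff[of pN p]) (auto simp: pN_def)
    finally show ?thesis by (simp add: sum_distrib_left case_prod_beta)
  qed
  also have "\<dots> \<le> e + c * (b - a) + e + e * (b - a)"
  proof -
    let ?l = "\<Sum>(x,K)\<in>pN. Sup K - Inf K"
    have "- c * ?l \<le> \<bar>c\<bar> * d"
      using pN by (intro mult_mono) auto
    moreover have "0 \<le> e * ?l" using pN \<open>e > 0\<close> by simp
    ultimately show ?thesis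
      using \<open>\<bar>c\<bar> * d \<le> e\<close> by (simp add: algebra_simps)
  qed
  also have "\<dots> = c * (b - a) + e * (b - a + 2)" by (simp add: algebra_simps)
  also have "e * (b - a + 2) = \<epsilon>" unfolding e_def using \<open>a \<le> b\<close> by simp
  finally show "f b - f a \<le> c * (b - a) + \<epsilon>" .
qed

section \<open>Trajectories and the minimum time\<close>

lemma trajectory_start: "trajectory F T x \<xi> \<Longrightarrow> \<xi> 0 = x"
  by (simp add: trajectory_def)

lemma trajectory_continuous_on: "trajectory F T x \<xi> \<Longrightarrow> continuous_on {0..T} \<xi>"
  by (simp add: trajectory_def abs_continuous_on_imp_continuous_on)

text \<open>The inner product with \<open>p\<close> yields a real function to which the increment
  bound applies. Since every admissible velocity is bounded, it does not matter which one the
  trajectory selects.\<close>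

lemma trajectory_increment_le:
  assumes traj: "trajectory F T x \<xi>" and s: "0 \<le> s" "s \<le> T"
    and bound: "\<And>r w. 0 \<le> r \<Longrightarrow> r \<le> s \<Longrightarrow> w \<in> F (\<xi> r) \<Longrightarrow> w \<bullet> p \<le> c"
  shows "(\<xi> s - x) \<bullet> p \<le> c * s"
proof -
  have sub: "{0..s} \<subseteq> {0..T}" using s by auto
  have "\<xi> s \<bullet> p - \<xi> 0 \<bullet> p \<le> c * (s - 0)"
  proof (rule abs_continuous_on_increment_le)
    show "0 \<le> s" by fact
    show "abs_continuous_on {0..s} (\<lambda>t. \<xi> t \<bullet> p)"
      using traj abs_continuous_on_subset[OF _ sub] abs_continuous_on_inner
      unfolding trajectory_def by blast
    have "AE t\<in>{0..T} in lebesgue. \<exists>v\<in>F (\<xi> t). (\<xi> has_vector_derivative v) (at t within {0..T})"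
      using traj by (simp add: trajectory_def)
    then show "AE t\<in>{0..s} in lebesgue. \<exists>d\<le>c. ((\<lambda>t. \<xi> t \<bullet> p) has_real_derivative d) (at t within {0..s})"
    proof (rule AE_mp, intro AE_I2 impI)
      fix t assume h: "t \<in> {0..T} \<longrightarrow> (\<exists>v\<in>F (\<xi> t). (\<xi> has_vector_derivative v) (at t within {0..T}))"
        and t: "t \<in> {0..s}"
      then obtain v where v: "v \<in> F (\<xi> t)" "(\<xi> has_vector_derivative v) (at t within {0..T})"
        using sub by blast
      have "((\<lambda>t. \<xi> t \<bullet> p) has_real_derivative v \<bullet> p) (at t within {0..s})"
        using bounded_linear.has_vector_derivative[OF bounded_linear_inner_left
            has_vector_derivative_within_subset[OF v(2) sub], of p]
        by (simp add: has_real_derivative_iff_has_vector_derivative)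
      then show "\<exists>d\<le>c. ((\<lambda>t. \<xi> t \<bullet> p) has_real_derivative d) (at t within {0..s})"
        using bound[of t v] t v(1) by auto
    qed
  qed
  then show ?thesis using traj by (simp add: trajectory_def inner_diff_left)
qed

text \<open>The displacement is tested against the unit vector in its own direction.\<close>

lemma trajectory_norm_le:
  assumes traj: "trajectory F T x \<xi>" and s: "0 \<le> s" "s \<le> T"
    and bound: "\<And>r w. 0 \<le> r \<Longrightarrow> r \<le> s \<Longrightarrow> w \<in> F (\<xi> r) \<Longrightarrow> norm w \<le> M"
  shows "norm (\<xi> s - x) \<le> M * s"
proof (cases "\<xi> s = x")
  case True
  \<comment> \<open>The choice \<open>p = 0\<close> yields \<open>0 \<le> M * s\<close> without a
    sign assumption on \<open>M\<close>: any admissible velocity has a norm between 0 and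
    \<open>M\<close>.\<close>
  have "(\<xi> s - x) \<bullet> 0 \<le> M * s"
  proof (rule trajectory_increment_le[OF traj s])
    fix r w assume "0 \<le> r" "r \<le> s" "w \<in> F (\<xi> r)"
    then have "norm w \<le> M" by (rule bound)
    then have "0 \<le> M" by (rule order_trans[OF norm_ge_zero])
    then show "w \<bullet> 0 \<le> M" by simp
  qed
  then show ?thesis using True by simp
next
  case False
  define p where "p = sgn (\<xi> s - x)"
  have np: "norm p = 1" using False by (simp add: p_def norm_sgn)
  have "(\<xi> s - x) \<bullet> p \<le> M * s"
  proof (rule trajectory_increment_le[OF traj s])
    fix r w assume "0 \<le> r" "r \<le> s" "w \<in> F (\<xi> r)"
    then have "norm w \<le> M" by (rule bound)
    then show "w \<bullet> p \<le> M" using norm_cauchy_schwarz[of w p] np by simp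
  qed
  moreover have "(\<xi> s - x) \<bullet> p = norm (\<xi> s - x)"
    using False by (simp add: p_def sgn_div_norm dot_square_norm power2_eq_square)
  ultimately show ?thesis by simp
qed

text \<open>At a first exit time from the closed ball, the velocity bound valid inside would already be violated.\<close>

lemma trajectory_stays_near:
  assumes traj: "trajectory F T x \<xi>" and s: "0 \<le> s" "s \<le> T"
    and bound: "\<And>z w. norm (z - x) \<le> \<rho> \<Longrightarrow> w \<in> F z \<Longrightarrow> norm w \<le> M"
    and "\<rho> > 0" "M \<ge> 0" "M * s < \<rho>"
  shows "norm (\<xi> s - x) \<le> M * s"
proof (rule ccontr)
  assume far: "\<not> norm (\<xi> s - x) \<le> M * s"
  define d where "d r = norm (\<xi> r - x)" for r
  have "continuous_on {0..s} \<xi>"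
    by (rule continuous_on_subset[OF trajectory_continuous_on[OF traj]]) (use s in auto)
  then have cont: "continuous_on {0..s} d"
    unfolding d_def by (intro continuous_intros)
  have vel: "norm w \<le> M" if "d r \<le> \<rho>" "w \<in> F (\<xi> r)" for r w
    using bound[of "\<xi> r" w] that by (simp add: d_def)
  have d0: "d 0 = 0" using trajectory_start[OF traj] by (simp add: d_def)
  have "\<exists>r\<in>{0..s}. d r > \<rho>"
  proof (rule ccontr)
    assume "\<not> (\<exists>r\<in>{0..s}. d r > \<rho>)"
    then have "norm (\<xi> s - x) \<le> M * s"
      by (intro trajectory_norm_le[OF traj s]) (auto simp: not_less intro: vel)
    then show False using far by simp
  qed
  \<comment> \<open>This set of hitting times is compact, so it has a least element, the first time
    at distance \<open>\<rho>\<close>.\<close>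
  define Z where "Z = {r\<in>{0..s}. d r = \<rho>}"
  from \<open>\<exists>r\<in>{0..s}. d r > \<rho>\<close> obtain r1 where r1: "0 \<le> r1" "r1 \<le> s" "d r1 > \<rho>" by auto
  then obtain r where "0 \<le> r" "r \<le> r1" "d r = \<rho>"
    using IVT'[of d 0 \<rho> r1] d0 \<open>\<rho> > 0\<close> continuous_on_subset[OF cont] by auto
  then have "r \<in> Z" using r1 by (simp add: Z_def)
  then have "Z \<noteq> {}" by blast
  have "compact Z"
  proof -
    have "closed ({0..s} \<inter> d -` {\<rho>})"
      by (rule continuous_closed_preimage[OF cont]) auto
    moreover have "Z = {0..s} \<inter> d -` {\<rho>}" by (auto simp: Z_def)
    ultimately show ?thesis by (simp add: compact_eq_bounded_closed bounded_Int)
  qed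
  from compact_attains_inf[OF this \<open>Z \<noteq> {}\<close>]
  obtain \<tau> where \<tau>: "\<tau> \<in> Z" "\<And>r. r \<in> Z \<Longrightarrow> \<tau> \<le> r"
    by auto
  have \<tau>s: "0 \<le> \<tau>" "\<tau> \<le> s" "d \<tau> = \<rho>" using \<tau>(1) by (auto simp: Z_def)
  \<comment> \<open>By the intermediate value theorem a larger distance at \<open>r\<close> needs an
    earlier hitting time, against the minimality of \<open>\<tau>\<close>.\<close>
  have inside: "d r \<le> \<rho>" if "0 \<le> r" "r \<le> \<tau>" for r
  proof (rule ccontr)
    assume "\<not> d r \<le> \<rho>"
    then have "\<exists>r'\<ge>0. r' \<le> r \<and> d r' = \<rho>"
      using IVT'[of d 0 \<rho> r] d0 that \<tau>s \<open>\<rho> > 0\<close> continuous_on_subset[OF cont] by auto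
    then obtain r' where r': "0 \<le> r'" "r' \<le> r" "d r' = \<rho>" by blast
    then have "\<tau> \<le> r'" using \<tau>(2)[of r'] that \<tau>s by (auto simp: Z_def)
    then have "r = r'" using r' that by simp
    with r' \<open>\<not> d r \<le> \<rho>\<close> show False by simp
  qed
  have "norm (\<xi> \<tau> - x) \<le> M * \<tau>"
    using \<tau>s s by (intro trajectory_norm_le[OF traj]) (auto intro: vel inside)
  then have "\<rho> \<le> M * s"
    using \<tau>s \<open>M \<ge> 0\<close> mult_left_mono[of \<tau> s M] by (simp add: d_def)
  then show False using \<open>M * s < \<rho>\<close> by simp
qed

lemma trajectory_shift:
  assumes traj: "trajectory F T x \<xi>" and \<tau>: "0 \<le> \<tau>" "\<tau> \<le> T"
  shows "trajectory F (T - \<tau>) (\<xi> \<tau>) (\<lambda>t. \<xi> (t + \<tau>))"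
  unfolding trajectory_def
proof (intro conjI)
  show "abs_continuous_on {0..T - \<tau>} (\<lambda>t. \<xi> (t + \<tau>))"
    using traj \<tau> unfolding trajectory_def
    by (intro abs_continuous_on_translate) (auto elim!: abs_continuous_on_subset)
  have "AE t\<in>{0..T} in lebesgue. \<exists>v\<in>F (\<xi> t). (\<xi> has_vector_derivative v) (at t within {0..T})"
    using traj by (simp add: trajectory_def)
  from AE_lebesgue_translate[OF this, of \<tau>]
  show "AE t\<in>{0..T - \<tau>} in lebesgue. \<exists>v\<in>F (\<xi> (t + \<tau>)).
      ((\<lambda>t. \<xi> (t + \<tau>)) has_vector_derivative v) (at t within {0..T - \<tau>})"
  proof (rule AE_mp, intro AE_I2 impI)
    fix t assume h: "\<tau> + t \<in> {0..T} \<longrightarrow> (\<exists>v\<in>F (\<xi> (\<tau> + t)). (\<xi> has_vector_derivative v) (at (\<tau> + t) within {0..T}))"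
      and t: "t \<in> {0..T - \<tau>}"
    then obtain v where v: "v \<in> F (\<xi> (t + \<tau>))" "(\<xi> has_vector_derivative v) (at (t + \<tau>) within {0..T})"
      using \<tau> by (auto simp: add.commute)
    have "((\<lambda>t. t + \<tau>) has_vector_derivative 1) (at t within {0..T - \<tau>})"
      by (auto intro!: derivative_eq_intros)
    moreover have "(\<xi> has_vector_derivative v) (at (t + \<tau>) within (\<lambda>t. t + \<tau>) ` {0..T - \<tau>})"
      by (rule has_vector_derivative_within_subset[OF v(2)]) (use \<tau> in auto)
    ultimately have "((\<lambda>t. \<xi> (t + \<tau>)) has_vector_derivative 1 *\<^sub>R v) (at t within {0..T - \<tau>})"
      using vector_diff_chain_within[of "\<lambda>t. t + \<tau>" 1 t "{0..T - \<tau>}" \<xi> v]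
      by (simp only: o_def)
    then show "\<exists>v\<in>F (\<xi> (t + \<tau>)). ((\<lambda>t. \<xi> (t + \<tau>)) has_vector_derivative v) (at t within {0..T - \<tau>})"
      using v(1) by auto
  qed
qed simp

lemma trajectory_concat:
  assumes \<zeta>: "trajectory F S x' \<zeta>" "\<zeta> S = x" and \<xi>: "trajectory F T x \<xi>" and "0 \<le> S" "0 \<le> T"
  shows "trajectory F (S + T) x' (\<lambda>t. if t \<le> S then \<zeta> t else \<xi> (t - S))"
    (is "trajectory F _ _ ?\<eta>")
  unfolding trajectory_def
proof (intro conjI)
  have \<xi>0: "\<xi> 0 = \<zeta> S" using \<zeta>(2) trajectory_start[OF \<xi>] by simp
  show "?\<eta> 0 = x'" using trajectory_start[OF \<zeta>(1)] \<open>0 \<le> S\<close> by simp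
  have right: "?\<eta> t = \<xi> (t + - S)" if "t \<ge> S" for t
    using that \<xi>0 by auto
  show "abs_continuous_on {0..S + T} ?\<eta>"
  proof (rule abs_continuous_on_join[where s = S])
    show "abs_continuous_on {0..S} ?\<eta>"
      using \<zeta>(1) by (subst abs_continuous_on_cong[where g = \<zeta>]) (auto simp: trajectory_def)
    have "abs_continuous_on {S..S + T} (\<lambda>t. \<xi> (t + - S))"
      using \<xi> by (intro abs_continuous_on_translate) (simp add: trajectory_def)
    then show "abs_continuous_on {S..S + T} ?\<eta>"
      using right by (subst abs_continuous_on_cong[where g = "\<lambda>t. \<xi> (t + - S)"]) (auto simp: \<xi>0)
  qed (use \<open>0 \<le> S\<close> \<open>0 \<le> T\<close> in auto)
  have 1: "AE t\<in>{0..S} in lebesgue. \<exists>v\<in>F (\<zeta> t). (\<zeta> has_vector_derivative v) (at t within {0..S})"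
    using \<zeta>(1) by (simp add: trajectory_def)
  have 2: "AE t in lebesgue. - S + t \<in> {0..T} \<longrightarrow>
      (\<exists>v\<in>F (\<xi> (- S + t)). (\<xi> has_vector_derivative v) (at (- S + t) within {0..T}))"
    using \<xi> by (intro AE_lebesgue_translate) (simp add: trajectory_def)
  \<comment> \<open>At the junction the one-sided velocities may differ; a single time is
    negligible.\<close>
  have 3: "AE t in lebesgue. t \<noteq> S"
    by (rule AE_I'[of "{S}"]) (auto simp: null_sets_completionI)
  from 1 2 3 show "AE t\<in>{0..S + T} in lebesgue. \<exists>v\<in>F (?\<eta> t). (?\<eta> has_vector_derivative v) (at t within {0..S + T})"
  proof eventually_elim
    case (elim t)
    show ?case
    proof
      assume t: "t \<in> {0..S + T}"
      show "\<exists>v\<in>F (?\<eta> t). (?\<eta> has_vector_derivative v) (at t within {0..S + T})"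
      proof (cases "t < S")
        case True
        then obtain v where v: "v \<in> F (\<zeta> t)" "(\<zeta> has_vector_derivative v) (at t within {0..S})"
          using elim t by auto
        \<comment> \<open>The derivative is taken within the whole interval; away from the junction
          this filter equals that of the piece containing \<open>t\<close>.\<close>
        have "at t within {0..S + T} = at t within {0..S}"
          using True t \<open>0 \<le> T\<close> by (intro at_within_nhd[of _ "{..<S}"]) auto
        moreover have "(?\<eta> has_vector_derivative v) (at t within {0..S})"
          using v(2) True t by (subst has_vector_derivative_cong_ev[where g = \<zeta>]) (auto simp: always_eventually)
        ultimately show ?thesis using v(1) True by auto
      next
        case False
        then have "t > S" using elim by simp
        then obtain v where v: "v \<in> F (\<xi> (t - S))" "(\<xi> has_vector_derivative v) (at (t - S) within {0..T})"
          using elim t by auto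
        have "((\<lambda>t. t - S) has_vector_derivative 1) (at t within {S..S + T})"
          by (auto intro!: derivative_eq_intros)
        moreover have "(\<xi> has_vector_derivative v) (at (t - S) within (\<lambda>t. t - S) ` {S..S + T})"
          by (rule has_vector_derivative_within_subset[OF v(2)]) auto
        ultimately have "((\<lambda>t. \<xi> (t - S)) has_vector_derivative 1 *\<^sub>R v) (at t within {S..S + T})"
          using vector_diff_chain_within[of "\<lambda>t. t - S" 1 t "{S..S + T}" \<xi> v]
          by (simp only: o_def)
        then have "(?\<eta> has_vector_derivative v) (at t within {S..S + T})"
          using \<open>t > S\<close> t right
          by (subst has_vector_derivative_cong_ev[where g = "\<lambda>t. \<xi> (t - S)"]) (auto simp: always_eventually \<xi>0)
        moreover have "at t within {0..S + T} = at t within {S..S + T}"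
          using \<open>t > S\<close> \<open>0 \<le> S\<close> by (intro at_within_nhd[of _ "{S<..}"]) auto
        ultimately show ?thesis using v(1) \<open>t > S\<close> by auto
      qed
    qed
  qed
qed

section \<open>Minimum time and nearly optimal trajectories\<close>

lemma min_time_nonneg: "0 \<le> min_time F K x"
  unfolding min_time_def by (auto intro!: Inf_greatest)

lemma min_time_le:
  assumes "trajectory F T x \<xi>" "\<xi> T \<in> K" "0 \<le> T"
  shows "min_time F K x \<le> ereal T"
\<comment> \<open>The infimum ranges over positive times only; \<open>T = 0\<close> puts
  \<open>x\<close> itself into \<open>K\<close>, where the value is 0 by definition.\<close>
proof (cases "T = 0 \<or> x \<in> K")
  case True
  then have "x \<in> K" using assms(2) trajectory_start[OF assms(1)] by auto
  then show ?thesis using assms(3) by (simp add: min_time_def)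
next
  case False
  then show ?thesis using assms by (auto simp: min_time_def intro!: Inf_lower)
qed

lemma min_time_near_optimal:
  assumes "x \<notin> K" "min_time F K x < ereal u"
  obtains T \<xi> where "0 < T" "T < u" "min_time F K x \<le> ereal T" "trajectory F T x \<xi>" "\<xi> T \<in> K"
proof -
  have "Inf {ereal T |T. T > 0 \<and> (\<exists>\<xi>. trajectory F T x \<xi> \<and> \<xi> T \<in> K)} < ereal u"
    using assms by (simp add: min_time_def)
  then obtain T \<xi> where "0 < T" "T < u" "trajectory F T x \<xi>" "\<xi> T \<in> K"
    by (auto simp: Inf_less_iff)
  then show thesis using that[of T \<xi>] min_time_le[of F T x \<xi> K] by simp
qed

lemma min_time_along_trajectory:
  assumes "trajectory F T x \<xi>" "\<xi> T \<in> K" "0 \<le> \<tau>" "\<tau> \<le> T"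
  shows "min_time F K (\<xi> \<tau>) \<le> ereal (T - \<tau>)"
  using assms by (intro min_time_le[OF trajectory_shift[OF assms(1,3,4)]]) auto

text \<open>One half of dynamic programming: travel from \<open>x'\<close> to \<open>x\<close>, then
  follow a nearly optimal trajectory. An upper bound \<open>t\<close> instead of the exact value
  lets it be applied at any height of the epigraph.\<close>

lemma min_time_dynamic_le:
  assumes \<zeta>: "trajectory F S x' \<zeta>" "\<zeta> S = x" "0 \<le> S" and x: "min_time F K x \<le> ereal t"
  shows "min_time F K x' \<le> ereal (t + S)"
proof (cases "x \<in> K")
  case True
  then have "min_time F K x' \<le> ereal S" using \<zeta> by (intro min_time_le[OF \<zeta>(1)]) auto
  also have "0 \<le> ereal t" by (rule order_trans[OF min_time_nonneg x])
  then have "ereal S \<le> ereal (t + S)" by simp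
  finally show ?thesis .
next
  case False
  show ?thesis
  proof (rule ereal_le_epsilon2)
    fix e :: real assume "e > 0"
    then have "min_time F K x < ereal (t + e)" by (intro le_less_trans[OF x]) simp
    then obtain T \<xi> where T: "0 < T" "T < t + e" "trajectory F T x \<xi>" "\<xi> T \<in> K"
      by (rule min_time_near_optimal[OF False])
    have "min_time F K x' \<le> ereal (S + T)"
      using T \<zeta>(2,3) trajectory_start[OF T(3)]
      by (intro min_time_le[OF trajectory_concat[OF \<zeta>(1,2) T(3)]]) auto
    also have "\<dots> \<le> ereal (t + S) + ereal e" using T by simp
    finally show "min_time F K x' \<le> ereal (t + S) + ereal e" .
  qed
qed

section \<open>The maximized Hamiltonian\<close>

lemma max_hamiltonian_ge:
  assumes "compact (F x)" "w \<in> F x"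
  shows "w \<bullet> p \<le> max_hamiltonian F x p"
  unfolding max_hamiltonian_def
proof (rule cSUP_upper[OF assms(2)])
  have "compact ((\<lambda>v. v \<bullet> p) ` F x)"
    using assms(1) by (intro compact_continuous_image continuous_intros)
  then show "bdd_above ((\<lambda>v. v \<bullet> p) ` F x)"
    by (intro bounded_imp_bdd_above compact_imp_bounded)
qed

lemma max_hamiltonian_attained:
  assumes "compact (F x)" "F x \<noteq> {}"
  obtains w where "w \<in> F x" "max_hamiltonian F x p = w \<bullet> p"
proof -
  obtain w where w: "w \<in> F x" "\<And>v. v \<in> F x \<Longrightarrow> v \<bullet> p \<le> w \<bullet> p"
    using continuous_attains_sup[OF assms, of "\<lambda>v. v \<bullet> p"]
      continuous_on_inner[OF continuous_on_id continuous_on_const] by blast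
  then have "max_hamiltonian F x p \<le> w \<bullet> p"
    unfolding max_hamiltonian_def using assms(2) by (intro cSUP_least) auto
  with max_hamiltonian_ge[of F x w p, OF assms(1) w(1)] w(1) that[of w] show thesis by simp
qed

text \<open>\<open>max_hamiltonian F x\<close> is the support function of \<open>F x\<close>. A
  maximizer over \<open>F x\<close> lies within \<open>L * norm (y - x)\<close> of a point of
  \<open>F y\<close>, which changes the inner product by at most that distance times
  \<open>norm p\<close>.\<close>

lemma max_hamiltonian_le_lipschitz:
  assumes "compact (F x)" "F x \<noteq> {}" "compact (F y)" "0 \<le> L"
    and lip: "F x \<subseteq> {w + (L * norm (y - x)) *\<^sub>R b |w b. w \<in> F y \<and> b \<in> cball 0 1}"
  shows "max_hamiltonian F x p \<le> max_hamiltonian F y p + L * norm (y - x) * norm p"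
proof -
  obtain v where v: "v \<in> F x" "max_hamiltonian F x p = v \<bullet> p"
    using max_hamiltonian_attained[of F x, OF assms(1,2)] by blast
  then obtain w b where wb: "v = w + (L * norm (y - x)) *\<^sub>R b" "w \<in> F y" "norm b \<le> 1"
    using lip by auto
  have "b \<bullet> p \<le> 1 * norm p"
    using norm_cauchy_schwarz[of b p] mult_right_mono[OF wb(3), of "norm p"] by simp
  then have "(L * norm (y - x)) * (b \<bullet> p) \<le> (L * norm (y - x)) * norm p"
    using assms(4) by (intro mult_left_mono) auto
  moreover have "w \<bullet> p \<le> max_hamiltonian F y p" by (rule max_hamiltonian_ge[of F, OF assms(3) wb(2)])
  ultimately show ?thesis using v(2) wb(1) by (simp add: inner_add_left)
qed

text \<open>For \<open>w\<close> maximizing at \<open>p\<close>, the function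
  \<open>max_hamiltonian F x q - w \<bullet> q\<close> of \<open>q\<close> is nonnegative and
  vanishes at \<open>p\<close>. Its derivative is zero at this minimum, which forces
  \<open>g = w\<close>.\<close>

lemma max_hamiltonian_gradient:
  assumes "compact (F x)" "F x \<noteq> {}" and G: "GDERIV (max_hamiltonian F x) p :> g"
  shows "g \<in> F x" "g \<bullet> p = max_hamiltonian F x p"
proof -
  obtain w where w: "w \<in> F x" "max_hamiltonian F x p = w \<bullet> p"
    using max_hamiltonian_attained[of F x, OF assms(1,2)] by blast
  have "((\<lambda>q. max_hamiltonian F x q - w \<bullet> q) has_derivative (\<lambda>h. h \<bullet> g - w \<bullet> h)) (at p)"
    using G unfolding gderiv_def by (intro derivative_intros)
  moreover have "\<forall>\<^sub>F q in at p. max_hamiltonian F x p - w \<bullet> p \<le> max_hamiltonian F x q - w \<bullet> q"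
    using w max_hamiltonian_ge[of F, OF assms(1) w(1)] by (intro always_eventually) simp
  ultimately have "(\<lambda>h. h \<bullet> g - w \<bullet> h) = (\<lambda>h. 0)"
    by (rule has_derivative_local_min)
  \<comment> \<open>The vanishing derivative is evaluated at \<open>h = g - w\<close>.\<close>
  then have "(g - w) \<bullet> g - w \<bullet> (g - w) = 0" by metis
  then have "(g - w) \<bullet> (g - w) = 0" by (simp add: inner_diff_left inner_diff_right inner_commute)
  then have "g = w" by simp
  with w show "g \<in> F x" "g \<bullet> p = max_hamiltonian F x p" by auto
qed

section \<open>Local solutions of Lipschitz differential equations\<close>

lemma picard_local:
  fixes g :: "'a::euclidean_space \<Rightarrow> 'a"
  assumes lip: "L-lipschitz_on UNIV g" and h: "0 \<le> h" "L * h \<le> 1 / 2"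
  obtains z where "z 0 = y" "\<And>t. t \<in> {0..h} \<Longrightarrow> (z has_vector_derivative g (z t)) (at t within {0..h})"
proof -
  \<comment> \<open>Clamping time to \<open>{0..h}\<close> makes the Picard operator act on bounded
    continuous functions on the whole line, a complete metric space given as a type, so that
    Banach's fixed point theorem applies.\<close>
  define c where "c t = max 0 (min h t)" for t :: real
  have c: "c t \<in> {0..h}" for t using h by (auto simp: c_def)
  have contg: "continuous_on A (\<lambda>s. g (u s))" if "continuous_on A u" for u :: "real \<Rightarrow> 'a" and A
    using continuous_on_compose2[OF lipschitz_on_continuous_on[OF lip] that] by simp
  define J where "J u t = y + integral {0..t} (\<lambda>s. g (u s))" for u :: "real \<Rightarrow> 'a" and t
  have contJ: "continuous_on {0..h} (J u)" if "continuous_on UNIV u" for u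
    unfolding J_def using that
    by (intro continuous_intros indefinite_integral_continuous_1 integrable_continuous_real contg)
      (auto elim: continuous_on_subset)
  have bc: "(\<lambda>t. J u (c t)) \<in> bcontfun" if "continuous_on UNIV u" for u
    unfolding bcontfun_def
  proof (intro CollectI conjI)
    show "continuous_on UNIV (\<lambda>t. J u (c t))"
      by (rule continuous_on_compose2[OF contJ[OF that]]) (use c in \<open>auto simp: c_def intro!: continuous_intros\<close>)
    have "bounded (J u ` {0..h})"
      by (intro compact_imp_bounded compact_continuous_image contJ that) auto
    then show "bounded (range (\<lambda>t. J u (c t)))"
      by (rule bounded_subset) (use c in auto)
  qed
  define \<Phi> where "\<Phi> u = Bcontfun (\<lambda>t. J (apply_bcontfun u) (c t))" for u :: "real \<Rightarrow>\<^sub>C 'a"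
  have \<Phi>: "apply_bcontfun (\<Phi> u) t = J (apply_bcontfun u) (c t)" for u t
    unfolding \<Phi>_def by (subst Bcontfun_inverse) (auto intro: bc)
  \<comment> \<open>The integrands differ by at most \<open>L * dist u w\<close> over a length of at
    most \<open>h\<close>, and \<open>L * h \<le> 1 / 2\<close>.\<close>
  have "dist (\<Phi> u) (\<Phi> w) \<le> 1 / 2 * dist u w" for u w
  proof (rule dist_bound)
    fix t
    let ?i = "\<lambda>u s. g (apply_bcontfun u s)"
    have int: "?i u integrable_on {0..c t}" for u
      by (intro integrable_continuous_real contg continuous_on_apply_bcontfun)
    have "dist (\<Phi> u t) (\<Phi> w t) = norm (integral {0..c t} (\<lambda>s. ?i u s - ?i w s))"
      by (simp add: \<Phi> J_def dist_norm integral_diff int)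
    also have "\<dots> \<le> (L * dist u w) * (c t - 0)"
    proof (rule integral_bound)
      show "continuous_on {0..c t} (\<lambda>s. ?i u s - ?i w s)"
        by (intro continuous_intros contg continuous_on_apply_bcontfun)
      fix s
      have "norm (?i u s - ?i w s) \<le> L * dist (u s) (w s)"
        using lipschitz_onD[OF lip, of "u s" "w s"] by (simp add: dist_norm)
      also have "\<dots> \<le> L * dist u w"
        using lipschitz_on_nonneg[OF lip] by (intro mult_left_mono dist_bounded)
      finally show "norm (?i u s - ?i w s) \<le> L * dist u w" .
    qed (use c in auto)
    also have "\<dots> = (L * c t) * dist u w" by simp
    also have "\<dots> \<le> 1 / 2 * dist u w"
    proof (rule mult_right_mono)
      have "L * c t \<le> L * h" using c lipschitz_on_nonneg[OF lip] by (intro mult_left_mono) auto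
      then show "L * c t \<le> 1 / 2" using h by simp
    qed simp
    finally show "dist (\<Phi> u t) (\<Phi> w t) \<le> 1 / 2 * dist u w" .
  qed
  then have "\<exists>!u. \<Phi> u = u" by (intro banach_fix_type[of "1 / 2"]) auto
  then obtain u where u: "\<Phi> u = u" by blast
  define z where "z = apply_bcontfun u"
  have z: "z t = y + integral {0..t} (\<lambda>s. g (z s))" if "t \<in> {0..h}" for t
    using \<Phi>[of u t] that by (simp add: u z_def J_def c_def)
  show thesis
  proof
    show "z 0 = y" using z[of 0] h by simp
    fix t assume t: "t \<in> {0..h}"
    have "((\<lambda>t. integral {0..t} (\<lambda>s. g (z s))) has_vector_derivative g (z t)) (at t within {0..h})"
      by (rule integral_has_vector_derivative[OF contg t]) (simp add: z_def continuous_on_apply_bcontfun)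
    then have "((\<lambda>t. y + integral {0..t} (\<lambda>s. g (z s))) has_vector_derivative g (z t)) (at t within {0..h})"
      by (auto intro!: derivative_eq_intros)
    then show "(z has_vector_derivative g (z t)) (at t within {0..h})"
      by (rule has_vector_derivative_transform[OF t, rotated]) (use z in auto)
  qed
qed

section \<open>Short trajectories\<close>

text \<open>First-order description of the short-time flow: in time s the largest displacement in direction p,
  forward or backward, is s times the maximized Hamiltonian, up to a quadratic error.\<close>

definition flow_bounds ::
    "('a::euclidean_space \<Rightarrow> 'a set) \<Rightarrow> real \<Rightarrow> real \<Rightarrow> real \<Rightarrow> real \<Rightarrow> bool" where
  "flow_bounds F R h M L \<longleftrightarrow> 0 < h \<and> 0 \<le> M \<and> 0 \<le> L \<and>
     (\<forall>x y p. norm x \<le> R \<longrightarrow> norm y \<le> R \<longrightarrow>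
        max_hamiltonian F x p \<le> max_hamiltonian F y p + L * norm (y - x) * norm p) \<and>
     (\<forall>T y \<xi> s p. norm y \<le> R \<longrightarrow> trajectory F T y \<xi> \<longrightarrow> 0 \<le> s \<longrightarrow> s \<le> T \<longrightarrow> s \<le> h \<longrightarrow>
        norm (\<xi> s - y) \<le> M * s \<and> (\<xi> s - y) \<bullet> p \<le> s * (max_hamiltonian F y p + L * norm p * (M * s))) \<and>
     (\<forall>y p s. norm y \<le> R \<longrightarrow> p \<noteq> 0 \<longrightarrow> 0 \<le> s \<longrightarrow> s \<le> h \<longrightarrow>
        (\<exists>y' \<zeta>. trajectory F s y' \<zeta> \<and> \<zeta> s = y \<and> norm (y' - y) \<le> M * s \<and>
           s * (max_hamiltonian F y p - L * norm p * (M * s)) \<le> (y - y') \<bullet> p))"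

lemma has_vector_derivative_reflect:
  assumes "(z has_vector_derivative v) (at (s - t) within {0..s})"
  shows "((\<lambda>t. z (s - t)) has_vector_derivative - v) (at t within {0..s})"
proof -
  have "((\<lambda>t. s - t) has_vector_derivative - 1) (at t within {0..s})"
    by (auto intro!: derivative_eq_intros)
  moreover have "(z has_vector_derivative v) (at (s - t) within (\<lambda>t. s - t) ` {0..s})"
    by (rule has_vector_derivative_within_subset[OF assms]) auto
  ultimately have "((\<lambda>t. z (s - t)) has_vector_derivative (- 1) *\<^sub>R v) (at t within {0..s})"
    using vector_diff_chain_within[of "\<lambda>t. s - t" "- 1" t "{0..s}" z v]
    by (simp only: o_def)
  then show ?thesis by simp
qed

text \<open>The gradient of the Hamiltonian in p is the maximizing velocity; freezing p makes it a locally
  Lipschitz selection of F, whose reversed flow consists of trajectories.\<close>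

lemma backward_trajectory:
  assumes F: "\<And>x. compact (F x)" "\<And>x. F x \<noteq> {}"
    and "R \<ge> 0" "0 \<le> M" "0 \<le> L" "0 \<le> h" "M * h \<le> 1" "L' * h \<le> 1 / 2" "p \<noteq> 0"
    and vel: "\<And>x w. norm x \<le> R + 1 \<Longrightarrow> w \<in> F x \<Longrightarrow> norm w \<le> M"
    and Hlip: "\<And>x y. norm x \<le> R + 1 \<Longrightarrow> norm y \<le> R + 1 \<Longrightarrow>
        max_hamiltonian F x p \<le> max_hamiltonian F y p + L * norm (y - x) * norm p"
    and grad: "\<And>x. norm x \<le> R + 1 \<Longrightarrow> GDERIV (max_hamiltonian F x) p :> G x"
    and Glip: "L'-lipschitz_on (cball 0 (R + 1)) G"
    and y: "norm y \<le> R" and s: "0 \<le> s" "s \<le> h"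
  obtains y' \<zeta> where "trajectory F s y' \<zeta>" "\<zeta> s = y" "norm (y' - y) \<le> M * s"
    "s * (max_hamiltonian F y p - L * norm p * (M * s)) \<le> (y - y') \<bullet> p"
proof -
  let ?Q = "cball 0 (R + 1) :: 'a set"
  have Q: "convex ?Q" "closed ?Q" "?Q \<noteq> {}" using \<open>R \<ge> 0\<close> by auto
  \<comment> \<open>Composing with the projection onto the ball extends the velocity field to the
    whole space without enlarging its Lipschitz constant; \<open>picard_local\<close> asks for a
    global field.\<close>
  define \<pi> where "\<pi> = closest_point ?Q"
  have \<pi>Q: "\<pi> x \<in> ?Q" for x unfolding \<pi>_def by (rule closest_point_in_set[OF Q(2,3)])
  define g where "g x = - G (\<pi> x)" for x
  have sel: "- g x \<in> F (\<pi> x)" for x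
    unfolding g_def using max_hamiltonian_gradient(1)[of F "\<pi> x", OF F grad] \<pi>Q[of x] by simp
  have gM: "norm (g x) \<le> M" for x
    using vel[OF _ sel[of x]] \<pi>Q[of x] by simp
  have "L'-lipschitz_on UNIV g"
  proof (rule lipschitz_onI)
    fix a b
    have "dist (g a) (g b) \<le> L' * dist (\<pi> a) (\<pi> b)"
      using lipschitz_onD[OF Glip \<pi>Q \<pi>Q] by (simp add: g_def dist_minus)
    also have "\<dots> \<le> L' * dist a b"
      unfolding \<pi>_def using closest_point_lipschitz[OF Q] lipschitz_on_nonneg[OF Glip]
      by (intro mult_left_mono)
    finally show "dist (g a) (g b) \<le> L' * dist a b" .
  qed (rule lipschitz_on_nonneg[OF Glip])
  moreover have "L' * s \<le> 1 / 2"
    using assms(8) mult_left_mono[OF s(2) lipschitz_on_nonneg[OF Glip]] by simp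
  ultimately obtain z where z0: "z 0 = y"
    and z: "\<And>t. t \<in> {0..s} \<Longrightarrow> (z has_vector_derivative g (z t)) (at t within {0..s})"
    using picard_local[OF _ s(1), of L' g y] by blast
  have zlip: "M-lipschitz_on {0..s} z"
  proof (rule bounded_derivative_imp_lipschitz)
    show "(z has_derivative (\<lambda>h. h *\<^sub>R g (z t))) (at t within {0..s})" if "t \<in> {0..s}" for t
      using z[OF that] by (simp add: has_vector_derivative_def)
    show "onorm (\<lambda>h. h *\<^sub>R g (z t)) \<le> M" for t
    proof (rule onorm_le)
      fix x show "norm (x *\<^sub>R g (z t)) \<le> M * norm x"
        using mult_left_mono[OF gM[of "z t"], of "\<bar>x\<bar>"] by (simp add: mult.commute)
    qed
  qed (use \<open>0 \<le> M\<close> in auto)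
  have near: "norm (z t - y) \<le> M * t" if "t \<in> {0..s}" for t
    using lipschitz_onD[OF zlip that, of 0] s that z0 by (simp add: dist_norm)
  have nears: "norm (z t - y) \<le> M * s" if "t \<in> {0..s}" for t
    using near[OF that] mult_left_mono[of t s M] that \<open>0 \<le> M\<close> by simp
  \<comment> \<open>The solution therefore stays in the ball of radius \<open>R + 1\<close>, where
    the projection is the identity and the field really selects from \<open>F\<close>.\<close>
  have "M * s \<le> 1" using mult_left_mono[OF s(2) \<open>0 \<le> M\<close>] \<open>M * h \<le> 1\<close> by simp
  have zQ: "norm (z t) \<le> R + 1" if "t \<in> {0..s}" for t
    using nears[OF that] norm_triangle_ineq[of y "z t - y"] y \<open>M * s \<le> 1\<close> by simp
  have \<pi>z: "\<pi> (z t) = z t" if "t \<in> {0..s}" for t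
    unfolding \<pi>_def using zQ[OF that] by (intro closest_point_self) simp
  define \<zeta> where "\<zeta> t = z (s - t)" for t
  have "trajectory F s (z s) \<zeta>"
    unfolding trajectory_def
  proof (intro conjI)
    have "M-lipschitz_on {0..s} \<zeta>"
    proof (rule lipschitz_onI)
      fix a b assume "a \<in> {0..s}" "b \<in> {0..s}"
      then show "dist (\<zeta> a) (\<zeta> b) \<le> M * dist a b"
        using lipschitz_onD[OF zlip, of "s - a" "s - b"] by (simp add: \<zeta>_def dist_real_def abs_minus_commute)
    qed fact
    then show "abs_continuous_on {0..s} \<zeta>" by (rule abs_continuous_onI_lipschitz)
    show "\<zeta> 0 = z s" by (simp add: \<zeta>_def)
    show "AE t\<in>{0..s} in lebesgue. \<exists>v\<in>F (\<zeta> t). (\<zeta> has_vector_derivative v) (at t within {0..s})"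
    proof (intro AE_I2 impI)
      fix t assume "t \<in> {0..s}"
      then have t: "s - t \<in> {0..s}" by auto
      have "(\<zeta> has_vector_derivative - g (z (s - t))) (at t within {0..s})"
        unfolding \<zeta>_def by (rule has_vector_derivative_reflect[OF z[OF t]])
      moreover have "- g (z (s - t)) \<in> F (\<zeta> t)"
        using sel[of "z (s - t)"] \<pi>z[OF t] by (simp add: \<zeta>_def)
      ultimately show "\<exists>v\<in>F (\<zeta> t). (\<zeta> has_vector_derivative v) (at t within {0..s})" by blast
    qed
  qed
  moreover have "\<zeta> s = y" by (simp add: \<zeta>_def z0)
  moreover have "norm (z s - y) \<le> M * s" using near[of s] s by simp
  moreover have "s * (max_hamiltonian F y p - L * norm p * (M * s)) \<le> (y - z s) \<bullet> p"
  proof -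
    \<comment> \<open>The estimate is made for the unreversed solution \<open>z\<close>, where
      \<open>g (z t) \<bullet> p = - max_hamiltonian F (z t) p\<close>; freezing the Hamiltonian at
      \<open>y\<close> costs the Lipschitz term.\<close>
    define c where "c = - (max_hamiltonian F y p - L * norm p * (M * s))"
    have "z s \<bullet> p - z 0 \<bullet> p \<le> c * (s - 0)"
    proof (rule abs_continuous_on_increment_le)
      show "abs_continuous_on {0..s} (\<lambda>t. z t \<bullet> p)"
        by (intro abs_continuous_on_inner abs_continuous_onI_lipschitz[OF zlip])
      show "AE t\<in>{0..s} in lebesgue. \<exists>d\<le>c. ((\<lambda>t. z t \<bullet> p) has_real_derivative d) (at t within {0..s})"
      proof (intro AE_I2 impI)
        fix t assume t: "t \<in> {0..s}"
        have "((\<lambda>t. z t \<bullet> p) has_real_derivative g (z t) \<bullet> p) (at t within {0..s})"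
          using bounded_linear.has_vector_derivative[OF bounded_linear_inner_left z[OF t], of p]
          by (simp add: has_real_derivative_iff_has_vector_derivative)
        moreover have "g (z t) \<bullet> p \<le> c"
        proof -
          have "g (z t) \<bullet> p = - max_hamiltonian F (z t) p"
            using max_hamiltonian_gradient(2)[of F "z t", OF F grad[OF zQ[OF t]]] \<pi>z[OF t]
            by (simp add: g_def)
          also have "\<dots> \<le> - max_hamiltonian F y p + L * norm (z t - y) * norm p"
            using Hlip[of y "z t"] y zQ[OF t] by simp
          also have "L * norm (z t - y) * norm p \<le> L * (M * s) * norm p"
            using nears[OF t] \<open>0 \<le> L\<close> by (intro mult_right_mono mult_left_mono) auto
          finally show ?thesis by (simp add: c_def algebra_simps)
        qed
        ultimately show "\<exists>d\<le>c. ((\<lambda>t. z t \<bullet> p) has_real_derivative d) (at t within {0..s})" by blast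
      qed
    qed fact
    then show ?thesis by (simp add: c_def z0 inner_diff_left algebra_simps)
  qed
  ultimately show thesis by (rule that)
qed

lemma flow_bounds_exists:
  assumes F: "assumption_F F" and H: "assumption_H F" and "R \<ge> 0"
  shows "\<exists>h M L. flow_bounds F R h M L"
proof -
  have F1: "compact (F x)" "F x \<noteq> {}" for x using F by (auto simp: assumption_F_def)
  obtain \<gamma> where "\<gamma> > 0" and \<gamma>: "\<And>x v. v \<in> F x \<Longrightarrow> norm v \<le> \<gamma> * (1 + norm x)"
    using F by (auto simp: assumption_F_def)
  obtain L where "L > 0" and L: "\<And>x y. x \<in> cball 0 (R + 1) \<Longrightarrow> y \<in> cball 0 (R + 1) \<Longrightarrow>
      F x \<subseteq> {w + (L * norm (y - x)) *\<^sub>R b |w b. w \<in> F y \<and> b \<in> cball 0 1}"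
  proof -
    from F[unfolded assumption_F_def, THEN conjunct2, THEN conjunct1, THEN spec, THEN mp,
        OF compact_cball[of 0 "R + 1"]]
    show thesis using that by blast
  qed
  \<comment> \<open>The gradient is given on open balls; this one contains the closed ball of radius
    \<open>R + 1\<close>, in which short trajectories from the ball of radius \<open>R\<close>
    remain.\<close>
  have "R + 2 > 0" using \<open>R \<ge> 0\<close> by simp
  then obtain G L' where grad: "\<And>x p. x \<in> ball 0 (R + 2) \<Longrightarrow> p \<noteq> 0 \<Longrightarrow> GDERIV (max_hamiltonian F x) p :> G x p"
    and Glip: "\<And>p. p \<noteq> 0 \<Longrightarrow> L'-lipschitz_on (ball 0 (R + 2)) (\<lambda>x. G x p)"
  proof -
    from H[unfolded assumption_H_def, THEN spec, THEN mp, OF \<open>R + 2 > 0\<close>, THEN conjunct2]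
    show thesis using that by blast
  qed
  \<comment> \<open>\<open>M\<close> is the linear growth bound at norm \<open>R + 1\<close>. In
    \<open>h\<close>, the first entry gives \<open>M * h < 1\<close>, so trajectories stay within
    the margin of width 1, and the second gives the contraction condition
    \<open>L' * h \<le> 1 / 2\<close>.\<close>
  define M where "M = \<gamma> * (2 + R)"
  define h where "h = min (1 / (2 * (M + 1))) (1 / (2 * (\<bar>L'\<bar> + 1)))"
  have "M \<ge> 0" using \<open>\<gamma> > 0\<close> \<open>R \<ge> 0\<close> by (simp add: M_def)
  then have "h > 0" by (simp add: h_def)
  have vel: "norm w \<le> M" if "norm x \<le> R + 1" "w \<in> F x" for x w
  proof -
    have "norm w \<le> \<gamma> * (1 + norm x)" by (rule \<gamma>[OF that(2)])
    also have "\<dots> \<le> M" unfolding M_def using that(1) \<open>\<gamma> > 0\<close> by (intro mult_left_mono) auto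
    finally show ?thesis .
  qed
  have "M * h \<le> M * (1 / (2 * (M + 1)))" using \<open>M \<ge> 0\<close> by (intro mult_left_mono) (auto simp: h_def)
  also have "\<dots> < 1" using \<open>M \<ge> 0\<close> by (simp add: field_simps)
  finally have "M * h < 1" .
  have "L' * h \<le> \<bar>L'\<bar> * (1 / (2 * (\<bar>L'\<bar> + 1)))"
    using \<open>h > 0\<close> by (intro mult_mono) (auto simp: h_def)
  also have "\<dots> \<le> 1 / 2" by (simp add: field_simps)
  finally have "L' * h \<le> 1 / 2" .
  have Hlip: "max_hamiltonian F x p \<le> max_hamiltonian F y p + L * norm (y - x) * norm p"
    if "norm x \<le> R + 1" "norm y \<le> R + 1" for x y p
    using that \<open>L > 0\<close> by (intro max_hamiltonian_le_lipschitz F1 L) auto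
  have "norm (\<xi> s - y) \<le> M * s \<and> (\<xi> s - y) \<bullet> p \<le> s * (max_hamiltonian F y p + L * norm p * (M * s))"
    if y: "norm y \<le> R" and traj: "trajectory F T y \<xi>" and s: "0 \<le> s" "s \<le> T" "s \<le> h" for T y \<xi> s p
  proof -
    have "M * s < 1" using mult_left_mono[OF s(3) \<open>M \<ge> 0\<close>] \<open>M * h < 1\<close> by simp
    have near: "norm (\<xi> r - y) \<le> M * r" if r: "0 \<le> r" "r \<le> s" for r
    proof (rule trajectory_stays_near[OF traj r(1), where \<rho> = 1])
      show "M * r < 1" using mult_left_mono[OF r(2) \<open>M \<ge> 0\<close>] \<open>M * s < 1\<close> by simp
      fix z w assume "norm (z - y) \<le> 1" "w \<in> F z"
      then show "norm w \<le> M" using y norm_triangle_ineq[of "z - y" y] by (intro vel) auto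
    qed (use r s \<open>M \<ge> 0\<close> in auto)
    have "(\<xi> s - y) \<bullet> p \<le> (max_hamiltonian F y p + L * norm p * (M * s)) * s"
    proof (rule trajectory_increment_le[OF traj s(1,2)])
      fix r w assume r: "0 \<le> r" "r \<le> s" and w: "w \<in> F (\<xi> r)"
      have d: "norm (\<xi> r - y) \<le> M * s"
        using near[OF r] mult_left_mono[OF r(2) \<open>M \<ge> 0\<close>] by simp
      have "w \<bullet> p \<le> max_hamiltonian F (\<xi> r) p" by (rule max_hamiltonian_ge[of F, OF F1(1) w])
      also have "\<dots> \<le> max_hamiltonian F y p + L * norm (y - \<xi> r) * norm p"
        using d y norm_triangle_ineq[of "\<xi> r - y" y] \<open>M * s < 1\<close> by (intro Hlip) auto
      also have "L * norm (y - \<xi> r) * norm p \<le> L * (M * s) * norm p"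
        using d \<open>L > 0\<close> by (intro mult_right_mono mult_left_mono) (auto simp: norm_minus_commute)
      finally show "w \<bullet> p \<le> max_hamiltonian F y p + L * norm p * (M * s)" by (simp add: mult_ac)
    qed
    then show ?thesis using near[of s] s by (simp add: mult.commute)
  qed
  moreover have "\<exists>y' \<zeta>. trajectory F s y' \<zeta> \<and> \<zeta> s = y \<and> norm (y' - y) \<le> M * s \<and>
           s * (max_hamiltonian F y p - L * norm p * (M * s)) \<le> (y - y') \<bullet> p"
    if y: "norm y \<le> R" and p: "p \<noteq> 0" and s: "0 \<le> s" "s \<le> h" for y p s
  proof -
    have glip: "L'-lipschitz_on (cball 0 (R + 1)) (\<lambda>x. G x p)"
      by (rule lipschitz_on_subset[OF Glip[OF p]]) auto
    have gder: "GDERIV (max_hamiltonian F x) p :> G x p" if "norm x \<le> R + 1" for x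
      using that by (intro grad[OF _ p]) auto
    show ?thesis
      by (rule backward_trajectory[OF F1 \<open>R \<ge> 0\<close> \<open>M \<ge> 0\<close> less_imp_le[OF \<open>L > 0\<close>]
            less_imp_le[OF \<open>h > 0\<close>] less_imp_le[OF \<open>M * h < 1\<close>] \<open>L' * h \<le> 1 / 2\<close> p vel Hlip gder glip y s])
        blast+
  qed
  ultimately have "flow_bounds F R h M L"
    unfolding flow_bounds_def using \<open>h > 0\<close> \<open>M \<ge> 0\<close> \<open>L > 0\<close> Hlip by (simp add: less_imp_le)
  then show ?thesis by blast
qed

section \<open>Normals to the epigraph\<close>

text \<open>Stands in for the limit as \<open>s\<close> tends to 0: a first-order comparison at a
  normal, divided by \<open>s\<close>, leaves a remainder linear in \<open>s\<close>.\<close>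

lemma le_zero_if_le_linear:
  fixes a B s0 :: real
  assumes "s0 > 0" and le: "\<And>s. 0 < s \<Longrightarrow> s \<le> s0 \<Longrightarrow> a \<le> B * s"
  shows "a \<le> 0"
proof (rule ccontr)
  assume "\<not> a \<le> 0"
  then have "a > 0" by simp
  define s where "s = min s0 (a / (2 * (\<bar>B\<bar> + 1)))"
  have "s > 0" "s \<le> s0" using \<open>a > 0\<close> \<open>s0 > 0\<close> by (auto simp: s_def)
  then have "a \<le> B * s" by (rule le)
  also have "\<dots> \<le> (\<bar>B\<bar> + 1) * (a / (2 * (\<bar>B\<bar> + 1)))"
    using \<open>s > 0\<close> by (intro mult_mono) (auto simp: s_def)
  also have "\<dots> = a / 2" by (simp add: field_simps)
  finally show False using \<open>a > 0\<close> by simp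
qed

text \<open>At distance at least \<open>\<rho>\<close>, Cauchy-Schwarz suffices, because a distance
  is then at most its square over \<open>\<rho>\<close>; this adds \<open>norm v / \<rho>\<close> to
  the constant. It allows points of the target, which stay away from \<open>x\<close>, to be
  ignored.\<close>

lemma proximal_normal_coneI_local:
  assumes "\<rho> > 0" "\<sigma> \<ge> 0"
    and le: "\<And>y. y \<in> E \<Longrightarrow> norm (y - x) < \<rho> \<Longrightarrow> v \<bullet> (y - x) \<le> \<sigma> * (norm (y - x))\<^sup>2"
  shows "v \<in> proximal_normal_cone E x"
  unfolding proximal_normal_cone_def
proof (intro CollectI exI conjI ballI)
  show "0 \<le> \<sigma> + norm v / \<rho>" using assms by simp
  fix y assume "y \<in> E"
  show "v \<bullet> (y - x) \<le> (\<sigma> + norm v / \<rho>) * (norm (y - x))\<^sup>2"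
  proof (cases "norm (y - x) < \<rho>")
    case True
    then have "v \<bullet> (y - x) \<le> \<sigma> * (norm (y - x))\<^sup>2" by (rule le[OF \<open>y \<in> E\<close>])
    also have "\<dots> \<le> (\<sigma> + norm v / \<rho>) * (norm (y - x))\<^sup>2"
      using \<open>\<rho> > 0\<close> by (intro mult_right_mono) auto
    finally show ?thesis .
  next
    case False
    have "v \<bullet> (y - x) \<le> norm v * norm (y - x)" by (rule norm_cauchy_schwarz)
    also have "\<dots> \<le> norm v * ((norm (y - x))\<^sup>2 / \<rho>)"
      using False \<open>\<rho> > 0\<close> by (intro mult_left_mono) (auto simp: le_divide_eq power2_eq_square mult_left_mono)
    also have "\<dots> \<le> (\<sigma> + norm v / \<rho>) * (norm (y - x))\<^sup>2"
      using \<open>\<sigma> \<ge> 0\<close> by (simp add: field_simps)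
    finally show ?thesis .
  qed
qed

lemma proximal_normal_cone_Pair:
  fixes E :: "('a::real_inner \<times> real) set"
  assumes "(v, l) \<in> proximal_normal_cone E (x, \<beta>)"
  obtains \<sigma> where "\<sigma> \<ge> 0" "\<And>y b. (y, b) \<in> E \<Longrightarrow>
      v \<bullet> (y - x) + l * (b - \<beta>) \<le> \<sigma> * ((norm (y - x))\<^sup>2 + (b - \<beta>)\<^sup>2)"
  using assms unfolding proximal_normal_cone_def by (force simp: norm_Pair)

text \<open>Source of the final constant: \<open>d\<close> is the distance of the tested point from
  \<open>x\<close>, \<open>s\<close> the time for which it is moved, \<open>e\<close> its distance
  afterwards. Both mixed terms are absorbed by \<open>2 * s * d \<le> d\<^sup>2 + s\<^sup>2\<close>,
  applied once with \<open>M * s\<close> in place of \<open>s\<close>.\<close>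

lemma quadratic_error_le:
  fixes e d s \<phi>\<^sub>0 n M L :: real
  assumes "0 \<le> e" "e \<le> d + M * s" "0 \<le> d" "0 \<le> s" "0 \<le> M" "0 \<le> L" "0 \<le> \<phi>\<^sub>0" "0 \<le> n"
  shows "\<phi>\<^sub>0 * n * e\<^sup>2 + s * (L * n * (d + M * s)) \<le> (2 * \<phi>\<^sub>0 * (1 + M\<^sup>2) + L * (1 + M)) * n * (d\<^sup>2 + s\<^sup>2)"
proof -
  have "e\<^sup>2 \<le> (d + M * s)\<^sup>2" using assms by (intro power_mono) auto
  also have "\<dots> \<le> 2 * d\<^sup>2 + 2 * (M * s)\<^sup>2"
    using zero_le_power2[of "d - M * s"] by (simp add: power2_sum power2_diff)
  also have "\<dots> \<le> 2 * (1 + M\<^sup>2) * (d\<^sup>2 + s\<^sup>2)"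
    by (simp add: algebra_simps power_mult_distrib)
  finally have 1: "\<phi>\<^sub>0 * n * e\<^sup>2 \<le> \<phi>\<^sub>0 * n * (2 * (1 + M\<^sup>2) * (d\<^sup>2 + s\<^sup>2))"
    using assms by (intro mult_left_mono) auto
  have "s * d \<le> d\<^sup>2 + s\<^sup>2"
  proof -
    have "0 \<le> s * d" using assms by simp
    moreover have "2 * (s * d) \<le> d\<^sup>2 + s\<^sup>2"
      using zero_le_power2[of "s - d"] by (simp add: power2_diff)
    ultimately show ?thesis by linarith
  qed
  moreover have "M * s\<^sup>2 \<le> M * (d\<^sup>2 + s\<^sup>2)" using assms by (intro mult_left_mono) auto
  ultimately have "s * (d + M * s) \<le> (1 + M) * (d\<^sup>2 + s\<^sup>2)"
    by (simp add: algebra_simps power2_eq_square)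
  then have "L * n * (s * (d + M * s)) \<le> L * n * ((1 + M) * (d\<^sup>2 + s\<^sup>2))"
    using assms by (intro mult_left_mono) auto
  with 1 show ?thesis by (simp add: algebra_simps)
qed

text \<open>A normal \<open>(v, l)\<close> at the point \<open>(x, t0)\<close> of the graph. The
  assumption \<open>normal\<close> is the proximal inequality of the epigraph in coordinates;
  \<open>norm x + 1 \<le> R\<close> keeps all points at distance up to 1 from \<open>x\<close>
  within reach of the flow bounds.\<close>

locale epigraph_normal =
  fixes F :: "'a::euclidean_space \<Rightarrow> 'a set" and K :: "'a set" and \<delta> R h M L t0 l \<sigma> :: real and x v :: 'a
  assumes F_ne: "F x \<noteq> {}" and K: "closed K" and fb: "flow_bounds F R h M L"
    and xR: "norm x + 1 \<le> R" and xK: "x \<notin> K"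
    and t0: "min_time F K x = ereal t0" "t0 \<le> \<delta>"
    and \<sigma>: "\<sigma> \<ge> 0"
    and normal: "\<And>y b. y \<notin> K \<Longrightarrow> min_time F K y \<le> ereal \<delta> \<Longrightarrow> min_time F K y \<le> ereal b \<Longrightarrow>
        v \<bullet> (y - x) + l * (b - t0) \<le> \<sigma> * ((norm (y - x))\<^sup>2 + (b - t0)\<^sup>2)"
begin

abbreviation "H \<equiv> max_hamiltonian F"

lemma h: "0 < h" and M: "0 \<le> M" and L: "0 \<le> L"
  using fb by (auto simp: flow_bounds_def)

lemma H_lipschitz: "norm a \<le> R \<Longrightarrow> norm b \<le> R \<Longrightarrow> H a p \<le> H b p + L * norm (b - a) * norm p"
  using fb by (simp add: flow_bounds_def)

lemma forward:
  assumes "norm y \<le> R" "trajectory F T y \<xi>" "0 \<le> s" "s \<le> T" "s \<le> h"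
  shows "norm (\<xi> s - y) \<le> M * s" "(\<xi> s - y) \<bullet> p \<le> s * (H y p + L * norm p * (M * s))"
  using fb assms unfolding flow_bounds_def by blast+

lemma backward:
  assumes "norm y \<le> R" "p \<noteq> 0" "0 \<le> s" "s \<le> h"
  obtains y' \<zeta> where "trajectory F s y' \<zeta>" "\<zeta> s = y" "norm (y' - y) \<le> M * s"
    "s * (H y p - L * norm p * (M * s)) \<le> (y - y') \<bullet> p"
  using fb assms unfolding flow_bounds_def by blast

lemma H_zero: "H x 0 = 0"
  using F_ne by (simp add: max_hamiltonian_def)

lemma away_from_target:
  obtains \<rho> where "\<rho> > 0" "\<And>y. norm (y - x) < \<rho> \<Longrightarrow> y \<notin> K"
proof -
  have "open (- K)" using K by auto
  then obtain \<rho> where "\<rho> > 0" "ball x \<rho> \<subseteq> - K" using xK openE by blast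
  then show thesis using that[of \<rho>] by (auto simp: subset_iff dist_norm norm_minus_commute)
qed

text \<open>The epigraph contains the vertical ray above \<open>(x, t0)\<close>, along which a
  positive \<open>l\<close> would violate the quadratic bound.\<close>

lemma l_nonpos: "l \<le> 0"
proof (rule le_zero_if_le_linear[of 1])
  fix s :: real assume "0 < s"
  have "v \<bullet> (x - x) + l * ((t0 + s) - t0) \<le> \<sigma> * ((norm (x - x))\<^sup>2 + ((t0 + s) - t0)\<^sup>2)"
    using xK t0 \<open>0 < s\<close> by (intro normal) auto
  then have "l * s \<le> (\<sigma> * s) * s" by (simp add: power2_eq_square)
  then show "l \<le> \<sigma> * s" using \<open>0 < s\<close> by simp
qed simp

text \<open>Slice of the epigraph at height \<open>t0\<close>, where the term with \<open>l\<close>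
  vanishes. Localization is needed because the epigraph has no points over \<open>K\<close>, while
  the sublevel set contains \<open>K\<close>.\<close>

lemma v_normal: "v \<in> proximal_normal_cone (reachable_within F K t0) x"
proof -
  obtain \<rho> where "\<rho> > 0" and \<rho>: "\<And>y. norm (y - x) < \<rho> \<Longrightarrow> y \<notin> K" by (rule away_from_target) blast
  show ?thesis
  proof (rule proximal_normal_coneI_local[OF \<open>\<rho> > 0\<close> \<sigma>])
    fix y assume "y \<in> reachable_within F K t0" "norm (y - x) < \<rho>"
    then have y: "y \<notin> K" "min_time F K y \<le> ereal t0" using \<rho> by (auto simp: reachable_within_def)
    then have "min_time F K y \<le> ereal \<delta>" using t0(2) order_trans[of _ "ereal t0" "ereal \<delta>"] by simp
    then show "v \<bullet> (y - x) \<le> \<sigma> * (norm (y - x))\<^sup>2"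
      using normal[OF y(1) _ y(2)] by simp
  qed
qed

text \<open>Backward trajectories from x reach points of the epigraph at rate one.\<close>

lemma hamiltonian_le:
  assumes "t0 < \<delta>"
  shows "H x (- v) \<le> - l"
\<comment> \<open>Backward trajectories come from the gradient of the Hamiltonian, which is given
  only at nonzero \<open>p\<close>.\<close>
proof (cases "v = 0")
  case True
  then show ?thesis using H_zero l_nonpos by simp
next
  case False
  obtain \<rho> where "\<rho> > 0" and \<rho>: "\<And>y. norm (y - x) < \<rho> \<Longrightarrow> y \<notin> K" by (rule away_from_target) blast
  \<comment> \<open>The three entries keep \<open>s\<close> within the flow time, the new point
    inside R(\<delta>), and that point outside \<open>K\<close>.\<close>
  define s0 where "s0 = min h (min (\<delta> - t0) (\<rho> / (2 * (M + 1))))"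
  have "s0 > 0" using h M \<open>\<rho> > 0\<close> assms by (simp add: s0_def)
  have "H x (- v) + l \<le> 0"
  proof (rule le_zero_if_le_linear[OF \<open>s0 > 0\<close>])
    fix s assume s: "0 < s" "s \<le> s0"
    have sh: "0 \<le> s" "s \<le> h" using s by (auto simp: s0_def)
    have "norm x \<le> R" "- v \<noteq> 0" using xR False by auto
    from backward[OF this sh] obtain y \<zeta> where y: "trajectory F s y \<zeta>" "\<zeta> s = x" "norm (y - x) \<le> M * s"
      "s * (H x (- v) - L * norm (- v) * (M * s)) \<le> (x - y) \<bullet> - v" .
    have "M * s \<le> M * (\<rho> / (2 * (M + 1)))"
      using s M by (intro mult_left_mono) (auto simp: s0_def)
    also have "\<dots> < \<rho>" using M \<open>\<rho> > 0\<close> by (simp add: field_simps add_nonneg_pos)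
    finally have "y \<notin> K" using y(3) by (intro \<rho>) simp
    have T: "min_time F K y \<le> ereal (t0 + s)"
      using min_time_dynamic_le[OF y(1,2) sh(1)] t0 by simp
    have "t0 + s \<le> \<delta>" using s by (simp add: s0_def)
    then have "min_time F K y \<le> ereal \<delta>" using T order_trans[of _ "ereal (t0 + s)" "ereal \<delta>"] by simp
    then have "v \<bullet> (y - x) + l * s \<le> \<sigma> * ((norm (y - x))\<^sup>2 + s\<^sup>2)"
      using normal[OF \<open>y \<notin> K\<close> _ T] by simp
    also have "\<dots> \<le> \<sigma> * ((M * s)\<^sup>2 + s\<^sup>2)"
      using y(3) \<sigma> by (intro mult_left_mono add_right_mono power_mono) auto
    finally have "s * (H x (- v) - L * norm v * (M * s)) + l * s \<le> \<sigma> * ((M * s)\<^sup>2 + s\<^sup>2)"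
      using y(4) by (simp add: inner_commute inner_diff_right)
    then have "(H x (- v) + l) * s \<le> ((L * norm v * M + \<sigma> * (M\<^sup>2 + 1)) * s) * s"
      by (simp add: algebra_simps power2_eq_square)
    then show "H x (- v) + l \<le> (L * norm v * M + \<sigma> * (M\<^sup>2 + 1)) * s"
      using s(1) by simp
  qed
  then show ?thesis by simp
qed

text \<open>Along nearly optimal trajectories from x the minimum time decreases at rate one.\<close>

lemma hamiltonian_ge:
  assumes "t0 > 0"
  shows "- l \<le> H x (- v)"
proof -
  obtain \<rho> where "\<rho> > 0" and \<rho>: "\<And>y. norm (y - x) < \<rho> \<Longrightarrow> y \<notin> K" by (rule away_from_target) blast
  \<comment> \<open>Here 1 ensures \<open>s\<^sup>2 \<le> s\<close>, and \<open>t0\<close> ensures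
    that the trajectory, which lasts at least \<open>t0\<close>, is still running at time
    \<open>s\<close>.\<close>
  define s0 where "s0 = min 1 (min h (min t0 (\<rho> / (2 * (M + 1)))))"
  have "s0 > 0" using h M \<open>\<rho> > 0\<close> assms by (simp add: s0_def)
  have "- l - H x (- v) \<le> 0"
  proof (rule le_zero_if_le_linear[OF \<open>s0 > 0\<close>])
    fix s assume s: "0 < s" "s \<le> s0"
    have sh: "0 \<le> s" "s \<le> h" "s \<le> t0" "s \<le> 1" using s by (auto simp: s0_def)
    \<comment> \<open>An excess of second order disappears in the linear remainder after division by
      \<open>s\<close>.\<close>
    have "min_time F K x < ereal (t0 + s\<^sup>2)" using t0 s by simp
    then obtain T \<xi> where T: "T < t0 + s\<^sup>2" "min_time F K x \<le> ereal T"
      and traj: "trajectory F T x \<xi>" "\<xi> T \<in> K"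
      by (rule min_time_near_optimal[OF xK])
    have Tt0: "t0 \<le> T" using T(2) t0(1) by simp
    have "s\<^sup>2 \<le> s" using sh by (simp add: power2_eq_square mult_left_le_one_le)
    have "norm x \<le> R" using xR by simp
    have sT: "s \<le> T" using sh Tt0 by simp
    note fw = forward[OF \<open>norm x \<le> R\<close> traj(1) sh(1) sT sh(2)]
    have "M * s \<le> M * (\<rho> / (2 * (M + 1)))"
      using s M by (intro mult_left_mono) (auto simp: s0_def)
    also have "\<dots> < \<rho>" using M \<open>\<rho> > 0\<close> by (simp add: field_simps add_nonneg_pos)
    finally have "\<xi> s \<notin> K" using fw(1) by (intro \<rho>) simp
    have Ts: "min_time F K (\<xi> s) \<le> ereal (T - s)"
      by (rule min_time_along_trajectory[OF traj sh(1) sT])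
    \<comment> \<open>The excess \<open>s\<^sup>2\<close> is outweighed by the elapsed time
      \<open>s\<close>, so the point is admissible even if \<open>t0 = \<delta>\<close>.\<close>
    have "T - s \<le> \<delta>" using T(1) \<open>s\<^sup>2 \<le> s\<close> t0(2) by simp
    then have "min_time F K (\<xi> s) \<le> ereal \<delta>" using Ts order_trans[of _ "ereal (T - s)" "ereal \<delta>"] by simp
    then have "v \<bullet> (\<xi> s - x) + l * (T - s - t0) \<le> \<sigma> * ((norm (\<xi> s - x))\<^sup>2 + (T - s - t0)\<^sup>2)"
      by (rule normal[OF \<open>\<xi> s \<notin> K\<close> _ Ts])
    also have "\<dots> \<le> \<sigma> * ((M * s)\<^sup>2 + s\<^sup>2)"
    proof -
      have "\<bar>T - s - t0\<bar> \<le> s" using T(1) Tt0 \<open>s\<^sup>2 \<le> s\<close> by linarith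
      then have "(T - s - t0)\<^sup>2 \<le> s\<^sup>2" by (rule power2_le_iff_abs_le[THEN iffD2, rotated]) (rule sh)
      moreover have "(norm (\<xi> s - x))\<^sup>2 \<le> (M * s)\<^sup>2" using fw(1) by (intro power_mono) auto
      ultimately show ?thesis using \<sigma> by (intro mult_left_mono add_mono)
    qed
    finally have "v \<bullet> (\<xi> s - x) + l * (T - t0) - l * s \<le> \<sigma> * ((M * s)\<^sup>2 + s\<^sup>2)"
      by (simp add: algebra_simps)
    moreover have "- (v \<bullet> (\<xi> s - x)) \<le> s * (H x (- v) + L * norm v * (M * s))"
      using fw(2)[of "- v"] by (simp add: inner_commute)
    moreover have "l * s\<^sup>2 \<le> l * (T - t0)"
      using T(1) l_nonpos by (intro mult_left_mono_neg) auto
    ultimately have "(- l - H x (- v)) * s \<le> ((L * norm v * M + \<sigma> * (M\<^sup>2 + 1) - l) * s) * s"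
      by (simp add: algebra_simps power2_eq_square)
    then show "- l - H x (- v) \<le> (L * norm v * M + \<sigma> * (M\<^sup>2 + 1) - l) * s"
      using s(1) by simp
  qed
  then show ?thesis by simp
qed

text \<open>Involves neither \<open>\<sigma>\<close> nor \<open>x\<close> nor the normal: this
  uniformity turns a proximal inequality with uncontrolled \<open>\<sigma>\<close> into convexity
  with a controlled constant.\<close>

definition "C \<phi>\<^sub>0 = 2 * \<phi>\<^sub>0 * (1 + M\<^sup>2) + L * (1 + M)" for \<phi>\<^sub>0 :: real

text \<open>From \<open>t0 < t\<close> and \<open>t \<le> \<delta>\<close> the bound
  \<open>hamiltonian_le\<close> becomes available. The elapsed time is only known to lie between
  \<open>t - t0\<close> and an arbitrary larger \<open>\<tau>\<close>, so the inequality is shown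
  for \<open>\<tau>\<close> first.\<close>

lemma normal_inequality_later:
  assumes "0 \<le> \<phi>\<^sub>0"
    and phi: "\<And>z. min_time F K z \<le> ereal t0 \<Longrightarrow> v \<bullet> (z - x) \<le> \<phi>\<^sub>0 * norm v * (norm (z - x))\<^sup>2"
    and y: "y \<notin> K" "min_time F K y = ereal t" "t0 < t" "t \<le> \<delta>" "t - t0 < h" "norm (y - x) \<le> 1"
  shows "v \<bullet> (y - x) + l * (t - t0) \<le> C \<phi>\<^sub>0 * norm v * ((norm (y - x))\<^sup>2 + (t - t0)\<^sup>2)"
proof -
  have yR: "norm y \<le> R" using y(6) xR norm_triangle_ineq[of "y - x" x] by simp
  have "0 \<le> t0" using min_time_nonneg[of F K x] t0(1) by simp
  have est: "v \<bullet> (y - x) + l * \<tau> \<le> C \<phi>\<^sub>0 * norm v * ((norm (y - x))\<^sup>2 + \<tau>\<^sup>2)"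
    if \<tau>: "t - t0 < \<tau>" "\<tau> \<le> h" for \<tau>
  proof -
    have "min_time F K y < ereal (t0 + \<tau>)" using y(2) \<tau>(1) by simp
    then obtain T \<xi> where T: "T < t0 + \<tau>" "min_time F K y \<le> ereal T"
      and traj: "trajectory F T y \<xi>" "\<xi> T \<in> K"
      by (rule min_time_near_optimal[OF y(1)])
    \<comment> \<open>The remaining duration is then exactly \<open>t0\<close>, which puts
      \<open>\<xi> s\<close> into R(t0).\<close>
    define s where "s = T - t0"
    have s: "0 \<le> s" "s \<le> T" "s \<le> h" "s \<le> \<tau>" using T y \<tau> \<open>0 \<le> t0\<close> by (auto simp: s_def)
    note fw = forward[OF yR traj(1) s(1-3)]
    have "min_time F K (\<xi> s) \<le> ereal (T - s)"
      by (rule min_time_along_trajectory[OF traj s(1,2)])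
    then have "v \<bullet> (\<xi> s - x) \<le> \<phi>\<^sub>0 * norm v * (norm (\<xi> s - x))\<^sup>2"
      by (intro phi) (simp add: s_def)
    moreover have "v \<bullet> (y - \<xi> s) \<le> s * (H y (- v) + L * norm v * (M * s))"
      using fw(2)[of "- v"] by (simp add: inner_diff_left inner_diff_right inner_commute)
    \<comment> \<open>Only the Hamiltonian at \<open>x\<close> is tied to \<open>l\<close>. The cost
      of moving from \<open>y\<close> to \<open>x\<close> is multiplied by \<open>s\<close> below
      and so becomes quadratic.\<close>
    moreover have "H y (- v) \<le> - l + L * norm (y - x) * norm v"
      using H_lipschitz[of y x "- v"] yR xR hamiltonian_le y by (simp add: norm_minus_commute)
    then have "s * (H y (- v) + L * norm v * (M * s)) \<le> s * (- l + L * norm (y - x) * norm v + L * norm v * (M * s))"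
      using s(1) by (intro mult_left_mono) auto
    ultimately have "v \<bullet> (y - x) + l * s
        \<le> \<phi>\<^sub>0 * norm v * (norm (\<xi> s - x))\<^sup>2 + s * (L * norm v * (norm (y - x) + M * s))"
      by (simp add: algebra_simps inner_diff_right)
    also have "\<dots> \<le> C \<phi>\<^sub>0 * norm v * ((norm (y - x))\<^sup>2 + s\<^sup>2)"
      unfolding C_def
    proof (rule quadratic_error_le)
      show "norm (\<xi> s - x) \<le> norm (y - x) + M * s"
        using fw(1) norm_triangle_ineq[of "\<xi> s - y" "y - x"] by simp
    qed (use M L assms(1) s in auto)
    also have "\<dots> \<le> C \<phi>\<^sub>0 * norm v * ((norm (y - x))\<^sup>2 + \<tau>\<^sup>2)"
      using M L assms(1) s by (intro mult_left_mono add_left_mono power_mono) (auto simp: C_def)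
    finally show ?thesis
      using mult_left_mono_neg[OF s(4) l_nonpos] by simp
  qed
  \<comment> \<open>Limit as \<open>\<tau>\<close> decreases to \<open>t - t0\<close>; the strict
    inequality \<open>t - t0 < h\<close> leaves room above.\<close>
  let ?f = "\<lambda>\<tau>. C \<phi>\<^sub>0 * norm v * ((norm (y - x))\<^sup>2 + \<tau>\<^sup>2) - l * \<tau>"
  have "(?f \<longlongrightarrow> ?f (t - t0)) (at_right (t - t0))"
    by (intro tendsto_intros)
  moreover have "\<forall>\<^sub>F \<tau> in at_right (t - t0). v \<bullet> (y - x) \<le> ?f \<tau>"
    unfolding eventually_at_right_field
    using y(5) est by (intro exI[of _ h]) (auto simp: le_diff_eq)
  ultimately have "v \<bullet> (y - x) \<le> ?f (t - t0)"
    by (rule tendsto_lowerbound) simp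
  then show ?thesis by simp
qed

lemma normal_inequality_earlier:
  assumes "0 \<le> \<phi>\<^sub>0"
    and phi: "\<And>z. min_time F K z \<le> ereal t0 \<Longrightarrow> v \<bullet> (z - x) \<le> \<phi>\<^sub>0 * norm v * (norm (z - x))\<^sup>2"
    and y: "min_time F K y \<le> ereal b" "b < t0" "t0 - b < h" "norm (y - x) \<le> 1"
  shows "v \<bullet> (y - x) + l * (b - t0) \<le> C \<phi>\<^sub>0 * norm v * ((norm (y - x))\<^sup>2 + (b - t0)\<^sup>2)"
proof -
  have "0 \<le> ereal b" by (rule order_trans[OF min_time_nonneg y(1)])
  then have Hge: "- l \<le> H x (- v)" using y(2) by (intro hamiltonian_ge) simp
  show ?thesis
  proof (cases "v = 0")
    case True
    then show ?thesis using Hge H_zero l_nonpos by simp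
  next
    case False
    have yR: "norm y \<le> R" using y(4) xR norm_triangle_ineq[of "y - x" x] by simp
    define s where "s = t0 - b"
    have s: "0 \<le> s" "s \<le> h" using y by (auto simp: s_def)
    have "- v \<noteq> 0" using False by simp
    from backward[OF yR this s] obtain y' \<zeta> where y': "trajectory F s y' \<zeta>" "\<zeta> s = y" "norm (y' - y) \<le> M * s"
      "s * (H y (- v) - L * norm (- v) * (M * s)) \<le> (y - y') \<bullet> - v" .
    have "min_time F K y' \<le> ereal (b + s)"
      by (rule min_time_dynamic_le[OF y'(1,2) s(1) y(1)])
    then have "v \<bullet> (y' - x) \<le> \<phi>\<^sub>0 * norm v * (norm (y' - x))\<^sup>2"
      by (intro phi) (simp add: s_def)
    moreover have "v \<bullet> (y - y') \<le> - (s * (H y (- v) - L * norm v * (M * s)))"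
      using y'(4) by (simp add: inner_commute)
    moreover have "- l - L * norm (y - x) * norm v \<le> H y (- v)"
      using H_lipschitz[of x y "- v"] yR xR Hge by simp
    then have "s * (- l - L * norm (y - x) * norm v) \<le> s * H y (- v)"
      using s(1) by (intro mult_left_mono) auto
    ultimately have "v \<bullet> (y - x) - l * s
        \<le> \<phi>\<^sub>0 * norm v * (norm (y' - x))\<^sup>2 + s * (L * norm v * (norm (y - x) + M * s))"
      by (simp add: algebra_simps inner_diff_right)
    also have "\<dots> \<le> C \<phi>\<^sub>0 * norm v * ((norm (y - x))\<^sup>2 + s\<^sup>2)"
      unfolding C_def
    proof (rule quadratic_error_le)
      show "norm (y' - x) \<le> norm (y - x) + M * s"
        using y'(3) norm_triangle_ineq[of "y' - y" "y - x"] by simp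
    qed (use M L assms(1) s in auto)
    finally show ?thesis by (simp add: s_def power2_commute algebra_simps)
  qed
qed

end

section \<open>Gluing the constants of all balls\<close>

lemma continuous_majorant:
  fixes D :: "nat \<Rightarrow> real"
  assumes "\<And>k. 0 \<le> D k"
  obtains g :: "real \<Rightarrow> real" where "continuous_on UNIV g" "\<And>r. 0 \<le> g r" "\<And>r. 0 \<le> r \<Longrightarrow> D (nat \<lceil>r\<rceil>) \<le> g r"
proof
  \<comment> \<open>The hinge \<open>max 0 (r - real k + 2)\<close> is at least 1 for
    \<open>k = nat \<lceil>r\<rceil>\<close> and \<open>r \<ge> 0\<close>, and vanishes once
    \<open>k \<ge> r + 2\<close>, so only finitely many hinges are active at any
    \<open>r\<close>.\<close>
  define G where "G n r = (\<Sum>k\<le>n. D k * max 0 (r - real k + 2))" for n :: nat and r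
  define g where "g r = G (nat \<lceil>r\<rceil> + 2) r" for r
  \<comment> \<open>The number of terms in \<open>g\<close> jumps with \<open>r\<close>, but
    additional terms vanish; hence \<open>g\<close> agrees locally with one fixed finite sum, which
    is continuous.\<close>
  have g_eq: "g r = G N r" if "nat \<lceil>r\<rceil> + 2 \<le> N" for r N
    unfolding g_def G_def
  proof (rule sum.mono_neutral_left)
    show "\<forall>k\<in>{..N} - {..nat \<lceil>r\<rceil> + 2}. D k * max 0 (r - real k + 2) = 0"
    proof
      fix k assume "k \<in> {..N} - {..nat \<lceil>r\<rceil> + 2}"
      then have "r - real k + 2 \<le> 0" by (auto simp: not_le) linarith
      then show "D k * max 0 (r - real k + 2) = 0" by simp
    qed
  qed (use that in auto)
  show "continuous_on UNIV g"
  proof (clarsimp simp: continuous_on_eq_continuous_at)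
    fix r :: real
    obtain N :: nat where N: "r < real N" using reals_Archimedean2 by blast
    have "continuous_on {..<real N} (G (N + 2))"
      unfolding G_def by (intro continuous_intros)
    moreover have "G (N + 2) u = g u" if "u \<in> {..<real N}" for u
      using that by (intro g_eq[symmetric]) (auto simp: nat_le_iff ceiling_le_iff)
    ultimately have "continuous_on {..<real N} g"
      by (rule continuous_on_eq)
    then show "isCont g r"
      using N by (simp add: continuous_on_eq_continuous_at)
  qed
  show "0 \<le> g r" for r
    unfolding g_def G_def using assms by (intro sum_nonneg) simp
  show "D (nat \<lceil>r\<rceil>) \<le> g r" if "0 \<le> r" for r
  proof -
    let ?k = "nat \<lceil>r\<rceil>"
    have "real ?k \<le> r + 1" using that by linarith
    then have "D ?k * 1 \<le> D ?k * max 0 (r - real ?k + 2)"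
      using assms by (intro mult_left_mono) auto
    also have "\<dots> \<le> g r"
    proof -
      have "?k \<in> {..?k + 2}" unfolding atMost_iff by (rule le_add1)
      then show ?thesis
        unfolding g_def G_def by (rule member_le_sum) (use assms in auto)
    qed
    finally show ?thesis by simp
  qed
qed

text \<open>The constant serves all \<open>x\<close> in a ball, while \<open>y\<close> is
  unrestricted: flow bounds are needed only near the base point.\<close>

lemma epigraph_phi_convex_local:
  assumes F: "assumption_F F" and H: "assumption_H F" and K: "closed K" and "\<phi>\<^sub>0 \<ge> 0"
    and conv: "\<And>t. t \<in> {0..\<delta>} \<Longrightarrow> phi_convex (\<lambda>_. \<phi>\<^sub>0) (reachable_within F K t)"
    and cont: "continuous_on (controllable_set F K) (min_time F K)"
    and "0 \<le> R"
  defines "E \<equiv> ereal_epigraph (reachable_within F K \<delta> - K) (min_time F K)"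
  shows "\<exists>C\<ge>0. \<forall>x \<beta> y b v l. norm x \<le> R \<longrightarrow> (x, \<beta>) \<in> E \<longrightarrow> (y, b) \<in> E \<longrightarrow>
      (v, l) \<in> proximal_normal_cone E (x, \<beta>) \<longrightarrow>
      v \<bullet> (y - x) + l * (b - \<beta>) \<le> C * norm (v, l) * ((norm (y - x))\<^sup>2 + (b - \<beta>)\<^sup>2)"
proof -
  have memE: "(y, b) \<in> E \<longleftrightarrow> y \<notin> K \<and> min_time F K y \<le> ereal \<delta> \<and> min_time F K y \<le> ereal b" for y b
    by (auto simp: E_def ereal_epigraph_def reachable_within_def)
  have F1: "F x \<noteq> {}" for x using F by (auto simp: assumption_F_def)
  obtain h M L where fb: "flow_bounds F (R + 1) h M L"
    using flow_bounds_exists[OF F H, of "R + 1"] \<open>0 \<le> R\<close> by auto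
  then have hML: "0 < h" "0 \<le> M" "0 \<le> L" by (auto simp: flow_bounds_def)
  define C0 where "C0 = 2 * \<phi>\<^sub>0 * (1 + M\<^sup>2) + L * (1 + M)"
  \<comment> \<open>The summands serve comparisons inside one sublevel set, points moved along
    trajectories, and points far from \<open>(x, \<beta>)\<close>.\<close>
  define C where "C = \<phi>\<^sub>0 + C0 + 1 / min 1 h"
  have C0: "0 \<le> C0" using hML \<open>\<phi>\<^sub>0 \<ge> 0\<close> by (simp add: C0_def)
  then have C: "\<phi>\<^sub>0 \<le> C" "C0 \<le> C" "1 / min 1 h \<le> C" "0 \<le> C"
    using hML \<open>\<phi>\<^sub>0 \<ge> 0\<close> by (auto simp: C_def add_nonneg_nonneg)
  have reach_convex: "v \<bullet> (y - x) \<le> \<phi>\<^sub>0 * norm v * (norm (y - x))\<^sup>2"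
    if "v \<in> proximal_normal_cone (reachable_within F K t) x" "min_time F K x \<le> ereal t"
      "min_time F K y \<le> ereal t" "t \<le> \<delta>" for v x y t
  proof -
    have "0 \<le> ereal t" by (rule order_trans[OF min_time_nonneg that(2)])
    then show ?thesis using conv[of t] that by (auto simp: phi_convex_def reachable_within_def)
  qed
  have "v \<bullet> (y - x) + l * (b - \<beta>) \<le> C * norm (v, l) * ((norm (y - x))\<^sup>2 + (b - \<beta>)\<^sup>2)"
    if x: "norm x \<le> R" "(x, \<beta>) \<in> E" and y: "(y, b) \<in> E"
      and vl: "(v, l) \<in> proximal_normal_cone E (x, \<beta>)" for x \<beta> y b v l
  proof -
    obtain \<sigma> where "\<sigma> \<ge> 0" and \<sigma>: "\<And>y b. (y, b) \<in> E \<Longrightarrow>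
        v \<bullet> (y - x) + l * (b - \<beta>) \<le> \<sigma> * ((norm (y - x))\<^sup>2 + (b - \<beta>)\<^sup>2)"
      by (rule proximal_normal_cone_Pair[OF vl]) blast
    have nv: "norm v \<le> norm (v, l)" by (simp add: norm_Pair real_le_rsqrt)
    let ?D = "(norm (y - x))\<^sup>2 + (b - \<beta>)\<^sup>2"
    have D0: "0 \<le> ?D" by simp
    have weaken: ?thesis
      if "v \<bullet> (y - x) + l * (b - \<beta>) \<le> c * norm v * d" "0 \<le> c" "c \<le> C" "d \<le> ?D" "0 \<le> d" for c d
    proof -
      have "c * norm v * d \<le> C * norm (v, l) * ?D"
        using that nv C(4) by (intro mult_mono) auto
      then show ?thesis using that(1) by simp
    qed
    have xE: "x \<notin> K" "min_time F K x \<le> ereal \<delta>" "min_time F K x \<le> ereal \<beta>" using x memE by auto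
    have yE: "y \<notin> K" "min_time F K y \<le> ereal \<delta>" "min_time F K y \<le> ereal b" using y memE by auto
    obtain t0 where t0: "min_time F K x = ereal t0"
      using xE(2) min_time_nonneg[of F K x] by (cases "min_time F K x") auto
    then have t0\<delta>: "t0 \<le> \<delta>" "t0 \<le> \<beta>" using xE by auto
    show ?thesis
    proof (cases "t0 < \<beta>")
      case True
      \<comment> \<open>Strictly above the graph, short vertical moves in both directions stay in
        the epigraph, so both signs of \<open>l\<close> are excluded.\<close>
      have "l * 1 \<le> 0"
      proof (rule le_zero_if_le_linear[of 1 _ \<sigma>])
        fix s :: real assume "0 < s"
        have "(x, \<beta> + s) \<in> E" using xE t0 t0\<delta> \<open>0 < s\<close> by (simp add: memE)
        from \<sigma>[OF this] show "l * 1 \<le> \<sigma> * s" using \<open>0 < s\<close> by (simp add: power2_eq_square)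
      qed simp
      moreover have "- l \<le> 0"
      proof (rule le_zero_if_le_linear[of "\<beta> - t0" _ \<sigma>])
        fix s :: real assume s: "0 < s" "s \<le> \<beta> - t0"
        have "(x, \<beta> - s) \<in> E" using xE t0 t0\<delta> s by (simp add: memE)
        from \<sigma>[OF this] have "(- l) * s \<le> (\<sigma> * s) * s" by (simp add: power2_eq_square)
        then show "- l \<le> \<sigma> * s" using s(1) by (rule mult_right_le_imp_le)
      qed (use True in simp)
      ultimately have "l = 0" by simp
      have "x \<in> controllable_set F K" by (simp add: controllable_set_def t0)
      then have "(min_time F K \<longlongrightarrow> min_time F K x) (at x within controllable_set F K)"
        using cont by (simp add: continuous_on_def)
      \<comment> \<open>Near \<open>x\<close> all of R(\<delta>) lies below height
        \<open>\<beta>\<close>, so its points outside \<open>K\<close>, taken at that height, belong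
        to the epigraph.\<close>
      then have "\<forall>\<^sub>F z in at x within controllable_set F K. min_time F K z < ereal \<beta>"
        using True t0 by (intro order_tendstoD) auto
      then obtain \<rho>1 where "\<rho>1 > 0" and \<rho>1: "\<And>z. z \<in> controllable_set F K \<Longrightarrow> z \<noteq> x \<Longrightarrow> dist z x < \<rho>1 \<Longrightarrow>
          min_time F K z < ereal \<beta>"
        unfolding eventually_at by blast
      have "open (- K)" using K by auto
      then obtain \<rho>2 where "\<rho>2 > 0" and \<rho>2: "ball x \<rho>2 \<subseteq> - K" using xE(1) openE by blast
      have "v \<in> proximal_normal_cone (reachable_within F K \<delta>) x"
      proof (rule proximal_normal_coneI_local[of "min \<rho>1 \<rho>2", OF _ \<open>\<sigma> \<ge> 0\<close>])
        fix z assume z: "z \<in> reachable_within F K \<delta>" "norm (z - x) < min \<rho>1 \<rho>2"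
        then have "z \<notin> K" using \<rho>2 by (auto simp: subset_iff dist_norm norm_minus_commute)
        moreover have z\<delta>: "min_time F K z \<le> ereal \<delta>" using z by (simp add: reachable_within_def)
        moreover have "min_time F K z \<le> ereal \<beta>"
        proof (cases "z = x")
          case False
          have "min_time F K z < \<infinity>" using z\<delta> by auto
          then show ?thesis
            using \<rho>1[of z] False z by (auto simp: controllable_set_def dist_norm)
        qed (use xE in simp)
        ultimately have "(z, \<beta>) \<in> E" by (simp add: memE)
        from \<sigma>[OF this] show "v \<bullet> (z - x) \<le> \<sigma> * (norm (z - x))\<^sup>2" by simp
      qed (use \<open>\<rho>1 > 0\<close> \<open>\<rho>2 > 0\<close> in simp)
      then have "v \<bullet> (y - x) \<le> \<phi>\<^sub>0 * norm v * (norm (y - x))\<^sup>2"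
        using xE yE by (intro reach_convex) auto
      then show ?thesis using \<open>l = 0\<close> C(1) \<open>\<phi>\<^sub>0 \<ge> 0\<close> by (intro weaken[of \<phi>\<^sub>0 "(norm (y - x))\<^sup>2"]) auto
    next
      case False
      then have "\<beta> = t0" using t0\<delta> by simp
      interpret epigraph_normal F K \<delta> "R + 1" h M L t0 l \<sigma> x v
        using F1 K fb x(1) xE(1) t0 t0\<delta>(1) \<open>\<sigma> \<ge> 0\<close> \<sigma> \<open>\<beta> = t0\<close>
        by unfold_locales (auto simp: memE)
      have phi: "v \<bullet> (z - x) \<le> \<phi>\<^sub>0 * norm v * (norm (z - x))\<^sup>2" if "min_time F K z \<le> ereal t0" for z
        using v_normal t0 that t0\<delta>(1) by (intro reach_convex) auto
      show ?thesis
      proof (cases "norm (y - x) \<le> 1 \<and> \<bar>b - t0\<bar> < h")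
        \<comment> \<open>The distance in the product space is at least \<open>min 1 h\<close>,
          hence at most its square divided by \<open>min 1 h\<close>; Cauchy-Schwarz does the
          rest.\<close>
        case False
        let ?d = "norm (y - x, b - t0)"
        have d: "?d\<^sup>2 = ?D" by (simp add: norm_Pair \<open>\<beta> = t0\<close>)
        have "norm (y - x) \<le> ?d" "\<bar>b - t0\<bar> \<le> ?d"
          by (simp_all add: norm_Pair real_le_rsqrt)
        then have "min 1 h \<le> ?d" using False by linarith
        then have "min 1 h * ?d \<le> ?d * ?d" by (rule mult_right_mono) simp
        also have "?d * ?d = ?D" using d by (simp add: power2_eq_square)
        finally have "min 1 h * ?d \<le> ?D" .
        then have "?d \<le> 1 / min 1 h * ?D" using hML(1) by (simp add: field_simps)
        also have "\<dots> \<le> C * ?D" by (rule mult_right_mono[OF C(3) D0])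
        finally have "norm (v, l) * ?d \<le> norm (v, l) * (C * ?D)" by (intro mult_left_mono) auto
        moreover have "v \<bullet> (y - x) + l * (b - t0) \<le> norm (v, l) * ?d"
          using norm_cauchy_schwarz[of "(v, l)" "(y - x, b - t0)"] by (simp add: inner_Pair)
        ultimately show ?thesis by (simp add: \<open>\<beta> = t0\<close> mult_ac)
      next
        case near: True
        show ?thesis
        proof (cases "b < t0")
          case True
          then have "v \<bullet> (y - x) + l * (b - t0) \<le> C0 * norm v * ((norm (y - x))\<^sup>2 + (b - t0)\<^sup>2)"
            using normal_inequality_earlier[OF \<open>\<phi>\<^sub>0 \<ge> 0\<close> phi yE(3)] near by (simp add: C_def C0_def)
          then show ?thesis using C0 C(2) by (intro weaken[of C0 ?D]) (auto simp: \<open>\<beta> = t0\<close>)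
        next
          case False
          obtain t where t: "min_time F K y = ereal t"
            using yE(2) min_time_nonneg[of F K y] by (cases "min_time F K y") auto
          then have tb: "t \<le> \<delta>" "t \<le> b" using yE by auto
          show ?thesis
          proof (cases "t \<le> t0")
            case True
            \<comment> \<open>Here \<open>y\<close> already lies in R(t0), and the extra height only
              helps.\<close>
            have "l * (b - t0) \<le> 0" using l_nonpos False by (simp add: mult_nonpos_nonneg)
            then have "v \<bullet> (y - x) + l * (b - \<beta>) \<le> \<phi>\<^sub>0 * norm v * (norm (y - x))\<^sup>2"
              using phi[of y] t True by (simp add: \<open>\<beta> = t0\<close>)
            then show ?thesis using C(1) \<open>\<phi>\<^sub>0 \<ge> 0\<close> by (intro weaken[of \<phi>\<^sub>0 "(norm (y - x))\<^sup>2"]) auto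
          next
            case False
            \<comment> \<open>The inequality is obtained at the lowest point over \<open>y\<close>;
              raising the height to \<open>b\<close> lowers the left side, since
              \<open>l \<le> 0\<close>, and enlarges the right side.\<close>
            then have "v \<bullet> (y - x) + l * (t - t0) \<le> C0 * norm v * ((norm (y - x))\<^sup>2 + (t - t0)\<^sup>2)"
              using normal_inequality_later[OF \<open>\<phi>\<^sub>0 \<ge> 0\<close> phi yE(1) t _ tb(1)] near tb(2) by (simp add: C_def C0_def)
            moreover have "l * (b - t0) \<le> l * (t - t0)"
              using l_nonpos tb(2) by (intro mult_left_mono_neg) auto
            moreover have "(t - t0)\<^sup>2 \<le> (b - t0)\<^sup>2"
              using False tb(2) by (intro power_mono) auto
            ultimately show ?thesis
              using C0 C(2) by (intro weaken[of C0 "(norm (y - x))\<^sup>2 + (t - t0)\<^sup>2"]) (auto simp: \<open>\<beta> = t0\<close>)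
          qed
        qed
      qed
    qed
  qed
  then show ?thesis using C(4) by blast
qed

theorem proposition5p1:
  fixes F :: "real ^ 'n \<Rightarrow> (real ^ 'n) set"
    and K :: "(real ^ 'n) set"
    and \<delta> \<phi>\<^sub>0 :: real
  assumes "assumption_F F"
    and "assumption_H F"
    and "closed K"
    and "\<delta> > 0"
    and "\<phi>\<^sub>0 \<ge> 0"
    and "\<And>t. t \<in> {0..\<delta>} \<Longrightarrow> phi_convex (\<lambda>_. \<phi>\<^sub>0) (reachable_within F K t)"
    and "continuous_on (controllable_set F K) (min_time F K)"
  shows "\<exists>\<phi>. phi_convex \<phi> (ereal_epigraph (reachable_within F K \<delta> - K) (min_time F K))"
proof -
  let ?E = "ereal_epigraph (reachable_within F K \<delta> - K) (min_time F K)"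
  \<comment> \<open>Integer radii yield a sequence of constants; a point \<open>x\<close> later uses
    the ball of radius \<open>nat \<lceil>norm x\<rceil>\<close>.\<close>
  have "\<exists>C\<ge>0. \<forall>x \<beta> y b v l. norm x \<le> real n \<longrightarrow> (x, \<beta>) \<in> ?E \<longrightarrow> (y, b) \<in> ?E \<longrightarrow>
      (v, l) \<in> proximal_normal_cone ?E (x, \<beta>) \<longrightarrow>
      v \<bullet> (y - x) + l * (b - \<beta>) \<le> C * norm (v, l) * ((norm (y - x))\<^sup>2 + (b - \<beta>)\<^sup>2)" for n :: nat
    by (rule epigraph_phi_convex_local[OF assms(1-3,5-7)]) auto
  then obtain D where D0: "\<And>n. 0 \<le> D n"
    and D: "\<And>n x \<beta> y b v l. norm x \<le> real n \<Longrightarrow> (x, \<beta>) \<in> ?E \<Longrightarrow> (y, b) \<in> ?E \<Longrightarrow>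
      (v, l) \<in> proximal_normal_cone ?E (x, \<beta>) \<Longrightarrow>
      v \<bullet> (y - x) + l * (b - \<beta>) \<le> D n * norm (v, l) * ((norm (y - x))\<^sup>2 + (b - \<beta>)\<^sup>2)"
    by metis
  obtain g :: "real \<Rightarrow> real" where g: "continuous_on UNIV g" "\<And>r. 0 \<le> g r" "\<And>r. 0 \<le> r \<Longrightarrow> D (nat \<lceil>r\<rceil>) \<le> g r"
    by (rule continuous_majorant[of D, OF D0]) blast
  have "phi_convex (\<lambda>z. g (norm (fst z))) ?E"
    unfolding phi_convex_def
  proof (intro conjI ballI)
    show "continuous_on ?E (\<lambda>z. g (norm (fst z)))"
      by (rule continuous_on_compose2[OF g(1)]) (auto intro!: continuous_intros)
    show "0 \<le> g (norm (fst z))" for z :: "(real ^ 'n) \<times> real" by (rule g(2))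
    fix z w vl assume zw: "z \<in> ?E" "w \<in> ?E" and vl: "vl \<in> proximal_normal_cone ?E z"
    obtain x \<beta> y b v l where eq: "z = (x, \<beta>)" "w = (y, b)" "vl = (v, l)"
      by (cases z, cases w, cases vl)
    have "norm x \<le> real (nat \<lceil>norm x\<rceil>)" by (rule real_nat_ceiling_ge)
    then have "v \<bullet> (y - x) + l * (b - \<beta>)
        \<le> D (nat \<lceil>norm x\<rceil>) * norm (v, l) * ((norm (y - x))\<^sup>2 + (b - \<beta>)\<^sup>2)"
      using zw vl unfolding eq by (rule D)
    also have "\<dots> \<le> g (norm x) * norm (v, l) * ((norm (y - x))\<^sup>2 + (b - \<beta>)\<^sup>2)"
      using g(3)[of "norm x"] by (intro mult_right_mono) auto
    finally show "vl \<bullet> (w - z) \<le> g (norm (fst z)) * norm vl * (norm (w - z))\<^sup>2"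
      by (simp add: eq inner_Pair norm_Pair)
  qed
  then show ?thesis by blast
qed

end
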